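(* Suppose that every $f_i$, $i\in[n]$, is differentiable with $\|\nabla f_i(x)-\nabla f_i(y)\|\le L\|x-y\|$ for all $x,y\in\mathbb{R}^d$ (for some constant $L>0$), that $h$ is convex and proximable, and that $F$ is $\mu$-RPL, i.e. there is $\mu>0$ such that $\|\mathcal{G}_\gamma(x)\|^2\ge 2\mu\,(F(x)-\min F)$ for every $x\in\mathbb{R}^d$, where $\gamma$ is the stepsize of Algorithm VR-SZD. Let $\alpha=1-\frac{\gamma\mu}{2}$ and $\theta=1-\frac{\mu\gamma}{2}-\mu\gamma m$. If $$0<\gamma<\min\left\{\frac1{4L},\ \frac2\mu\,\frac1{2m+1},\ \frac{\sqrt{b\theta}}{10mL}\sqrt{\frac{\ell}{d}}\right\},$$ then the iterates of Algorithm VR-SZD satisfy, for every outer iteration $\tau\ge0$, $$\mathbb{E}\big[F(x_0^{\tau+1})-\min F\big]\le\alpha^{m(\tau+1)}\left(\mathbb{E}\big[F(x_0^0)-\min F\big]+\frac{1-\alpha^m}{1-\alpha}\,\gamma\left[\frac{3L^2d^2}{\ell}+\frac{L^2d}{2}\right]\sum_{i=0}^{\tau}\frac{\beta_i^2}{\alpha^{m(i+1)}}\right).$$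
   Context: Problem: minimize over $x\in\mathbb{R}^d$ the function $F(x):=f(x)+h(x)$ with $f(x):=\frac1n\sum_{i=1}^n f_i(x)$, where $f_i:\mathbb{R}^d\to\mathbb{R}$ are differentiable (possibly non-convex) and $h:\mathbb{R}^d\to\mathbb{R}\cup\{+\infty\}$ is convex, possibly non-differentiable, and proximable, meaning that for all $x\in\mathbb{R}^d$, $\gamma>0$ the point $\mathrm{prox}_{\gamma h}(x):=\arg\min_y\{h(y)+\frac{1}{2\gamma}\|y-x\|^2\}$ is well defined and can be computed cheaply. $\min F$ denotes the minimum value of $F$, assumed to exist. $[n]=\{1,\dots,n\}$, $(e_j)_{j=1}^d$ is the canonical basis of $\mathbb{R}^d$, and $O(d)$ is the group of orthogonal $d\times d$ matrices; "uniformly from $O(d)$" means according to the normalized Haar measure. Finite-difference surrogates: for $\beta>0$, $g(x,\beta):=\sum_{j=1}^d\frac{f(x+\beta e_j)-f(x)}{\beta}e_j$; for $i\in[n]$, $G\in O(d)$, $\hat g_i(x,G,\beta):=\frac{d}{\ell}\sum_{j=1}^\ell\frac{f_i(x+\beta Ge_j)-f_i(x)}{\beta}Ge_j$. Algorithm VR-SZD. Input: $x_0^0\in\mathbb{R}^d$, $T,m\in\mathbb{N}_+$, stepsize $\gamma>0$, $(\beta_\tau)_{\tau\in\mathbb{N}}\subset(0,\infty)$, an integer $1\le\ell\le d$, and a batch size $b\in\mathbb{N}_+$. For $\tau=0,\dots,T$: for $k=0,\dots,m-1$, sample $i_{1,k}^\tau,\dots,i_{b,k}^\tau$ uniformly from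 $[n]$ with replacement and $G_{1,k}^\tau,\dots,G_{b,k}^\tau$ uniformly from $O(d)$ (all independent of each other and of the past), and set $$v_k^\tau=\frac1b\sum_{j=1}^b\Big(\hat g_{i_{j,k}^\tau}(x_k^\tau,G_{j,k}^\tau,\beta_\tau)-\hat g_{i_{j,k}^\tau}(x_0^\tau,G_{j,k}^\tau,\beta_\tau)\Big)+g(x_0^\tau,\beta_\tau),\qquad x_{k+1}^\tau=\mathrm{prox}_{\gamma h}(x_k^\tau-\gamma v_k^\tau);$$ then set $x_0^{\tau+1}=x_m^\tau$. Gradient mapping: $\mathcal{G}_\gamma(x):=\frac1\gamma\big(x-\mathrm{prox}_{\gamma h}(x-\gamma\nabla f(x))\big)$. *)

theory Defs
  imports "HOL-Probability.Probability"
begin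

definition gradient :: "('a::real_inner \<Rightarrow> real) \<Rightarrow> 'a \<Rightarrow> 'a" where
  "gradient f x = (THE D. GDERIV f x :> D)"

definition f_avg :: "nat \<Rightarrow> (nat \<Rightarrow> 'a \<Rightarrow> real) \<Rightarrow> 'a \<Rightarrow> real" where
  "f_avg n f x = (1 / real n) * (\<Sum>i=1..n. f i x)"

definition objective :: "('a \<Rightarrow> real) \<Rightarrow> ('a \<Rightarrow> ereal) \<Rightarrow> 'a \<Rightarrow> ereal" where
  "objective f h x = ereal (f x) + h x"

text \<open>Convexity of a function with values in the reals extended by plus infinity. The value minus
  infinity has to be excluded separately. Since \<open>0 * \<infinity> = 0\<close> in \<^typ>\<open>ereal\<close>, the cases
  \<open>t = 0\<close> and \<open>t = 1\<close> give no constraint.\<close>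

definition convex_ereal :: "('a::real_vector \<Rightarrow> ereal) \<Rightarrow> bool" where
  "convex_ereal h \<longleftrightarrow> (\<forall>x y. \<forall>t\<in>{0..1::real}.
     h ((1 - t) *\<^sub>R x + t *\<^sub>R y) \<le> ereal (1 - t) * h x + ereal t * h y)"

definition prox_objective ::
  "real \<Rightarrow> ('a::real_normed_vector \<Rightarrow> ereal) \<Rightarrow> 'a \<Rightarrow> 'a \<Rightarrow> ereal" where
  "prox_objective \<gamma> h x y = h y + ereal (1 / (2 * \<gamma>) * (norm (y - x))\<^sup>2)"

definition prox :: "real \<Rightarrow> ('a::real_normed_vector \<Rightarrow> ereal) \<Rightarrow> 'a \<Rightarrow> 'a" where
  "prox \<gamma> h x = arg_min (prox_objective \<gamma> h x) (\<lambda>_. True)"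

definition proximable :: "('a::real_normed_vector \<Rightarrow> ereal) \<Rightarrow> bool" where
  "proximable h \<longleftrightarrow>
     (\<forall>x \<gamma>. \<gamma> > 0 \<longrightarrow> (\<exists>!y. is_arg_min (prox_objective \<gamma> h x) (\<lambda>_. True) y))"

definition has_minimum :: "('a \<Rightarrow> ereal) \<Rightarrow> bool" where
  "has_minimum F \<longleftrightarrow> (\<exists>x. is_arg_min F (\<lambda>_. True) x)"

text \<open>The minimum value of \<open>F\<close>, provided that \<^const>\<open>has_minimum\<close> holds.\<close>

definition min_value :: "('a \<Rightarrow> ereal) \<Rightarrow> ereal" where
  "min_value F = (INF x. F x)"

definition gradient_mapping ::
  "real \<Rightarrow> ('a::real_inner \<Rightarrow> real) \<Rightarrow> ('a \<Rightarrow> ereal) \<Rightarrow> 'a \<Rightarrow> 'a" where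
  "gradient_mapping \<gamma> f h x = (1 / \<gamma>) *\<^sub>R (x - prox \<gamma> h (x - \<gamma> *\<^sub>R gradient f x))"

definition RPL ::
  "real \<Rightarrow> real \<Rightarrow> ('a::real_inner \<Rightarrow> real) \<Rightarrow> ('a \<Rightarrow> ereal) \<Rightarrow> bool" where
  "RPL \<mu> \<gamma> f h \<longleftrightarrow> \<mu> > 0 \<and>
     (\<forall>x. ereal ((norm (gradient_mapping \<gamma> f h x))\<^sup>2)
        \<ge> ereal (2 * \<mu>) * (objective f h x - min_value (objective f h)))"


text \<open>The group \<open>O(d)\<close> with its Borel sigma-algebra. The normalized Haar measure is the unique
  probability measure on it that is invariant under left translations.\<close>

definition O_borel :: "(real ^ 'd ^ 'd) measure" where
  "O_borel = restrict_space borel {Q. orthogonal_matrix Q}"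

definition haar_O :: "(real ^ 'd ^ 'd) measure \<Rightarrow> bool" where
  "haar_O \<nu> \<longleftrightarrow> prob_space \<nu> \<and> sets \<nu> = sets O_borel \<and>
     (\<forall>Q. orthogonal_matrix Q \<longrightarrow> distr \<nu> O_borel (\<lambda>X. Q ** X) = \<nu>)"


text \<open>In what follows \<open>e 1, \<dots>, e d\<close> is an enumeration of the canonical basis of the space of
  dimension \<open>d = CARD('d)\<close>.\<close>

definition fd_gradient ::
  "(nat \<Rightarrow> real ^ 'd) \<Rightarrow> (real ^ 'd \<Rightarrow> real) \<Rightarrow> real ^ 'd \<Rightarrow> real \<Rightarrow> real ^ 'd" where
  "fd_gradient e f x \<beta> = (\<Sum>j=1..CARD('d). ((f (x + \<beta> *\<^sub>R e j) - f x) / \<beta>) *\<^sub>R e j)"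

definition fd_surrogate ::
  "(nat \<Rightarrow> real ^ 'd) \<Rightarrow> nat \<Rightarrow> (real ^ 'd \<Rightarrow> real) \<Rightarrow> real ^ 'd \<Rightarrow> real ^ 'd ^ 'd \<Rightarrow> real \<Rightarrow> real ^ 'd"
  where
  "fd_surrogate e l f x G \<beta> = (real CARD('d) / real l) *\<^sub>R
     (\<Sum>j=1..l. ((f (x + \<beta> *\<^sub>R (G *v e j)) - f x) / \<beta>) *\<^sub>R (G *v e j))"

text \<open>Search direction at the inner iterate \<open>x\<close> for the snapshot point \<open>y\<close>, with the batch of
  sampled indices \<open>idx j\<close> and sampled matrices \<open>Gs j\<close>, \<open>j = 1, \<dots>, b\<close>.\<close>

definition vr_direction ::
  "(nat \<Rightarrow> real ^ 'd) \<Rightarrow> nat \<Rightarrow> nat \<Rightarrow> nat \<Rightarrow> (nat \<Rightarrow> real ^ 'd \<Rightarrow> real) \<Rightarrow> real \<Rightarrow>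
    (nat \<Rightarrow> nat) \<Rightarrow> (nat \<Rightarrow> real ^ 'd ^ 'd) \<Rightarrow> real ^ 'd \<Rightarrow> real ^ 'd \<Rightarrow> real ^ 'd" where
  "vr_direction e l b n f \<beta> idx Gs y x =
     (1 / real b) *\<^sub>R (\<Sum>j=1..b. fd_surrogate e l (f (idx j)) x (Gs j) \<beta>
                              - fd_surrogate e l (f (idx j)) y (Gs j) \<beta>)
     + fd_gradient e (f_avg n f) y \<beta>"

primrec vr_inner ::
  "(nat \<Rightarrow> real ^ 'd) \<Rightarrow> nat \<Rightarrow> nat \<Rightarrow> nat \<Rightarrow> (nat \<Rightarrow> real ^ 'd \<Rightarrow> real) \<Rightarrow> (real ^ 'd \<Rightarrow> ereal) \<Rightarrow>
    real \<Rightarrow> real \<Rightarrow> (nat \<Rightarrow> nat \<Rightarrow> nat) \<Rightarrow> (nat \<Rightarrow> nat \<Rightarrow> real ^ 'd ^ 'd) \<Rightarrow>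
    real ^ 'd \<Rightarrow> nat \<Rightarrow> real ^ 'd" where
  "vr_inner e l b n f h \<gamma> \<beta> idx Gs y 0 = y"
| "vr_inner e l b n f h \<gamma> \<beta> idx Gs y (Suc k) =
     (let x = vr_inner e l b n f h \<gamma> \<beta> idx Gs y k
      in prox \<gamma> h (x - \<gamma> *\<^sub>R vr_direction e l b n f \<beta> (idx k) (Gs k) y x))"

text \<open>\<open>vr_szd \<dots> x0 \<tau>\<close> is the snapshot point of outer iteration \<open>\<tau>\<close>. The samples are
  \<open>idx \<tau> k j\<close> and \<open>Gs \<tau> k j\<close> with outer index \<open>\<tau>\<close>, inner index \<open>k < m\<close> and batch index
  \<open>j = 1, \<dots>, b\<close>.\<close>

primrec vr_szd ::
  "(nat \<Rightarrow> real ^ 'd) \<Rightarrow> nat \<Rightarrow> nat \<Rightarrow> nat \<Rightarrow> (nat \<Rightarrow> real ^ 'd \<Rightarrow> real) \<Rightarrow> (real ^ 'd \<Rightarrow> ereal) \<Rightarrow>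
    real \<Rightarrow> (nat \<Rightarrow> real) \<Rightarrow> nat \<Rightarrow> (nat \<Rightarrow> nat \<Rightarrow> nat \<Rightarrow> nat) \<Rightarrow>
    (nat \<Rightarrow> nat \<Rightarrow> nat \<Rightarrow> real ^ 'd ^ 'd) \<Rightarrow> real ^ 'd \<Rightarrow> nat \<Rightarrow> real ^ 'd" where
  "vr_szd e l b n f h \<gamma> \<beta> m idx Gs x0 0 = x0"
| "vr_szd e l b n f h \<gamma> \<beta> m idx Gs x0 (Suc \<tau>) =
     vr_inner e l b n f h \<gamma> (\<beta> \<tau>) (idx \<tau>) (Gs \<tau>) (vr_szd e l b n f h \<gamma> \<beta> m idx Gs x0 \<tau>) m"

text \<open>Sampling scheme: each index-matrix pair has the product law of the uniform distribution on
  \<open>{1..n}\<close> and the Haar measure \<open>\<nu>\<close> (so the two components are independent), and all pairs are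
  mutually independent; together this is mutual independence of all sampled indices and matrices.
  \<^const>\<open>prob_space.indep_vars\<close> includes measurability of the pairs.\<close>

definition vr_sampling ::
  "'w measure \<Rightarrow> (real ^ 'd ^ 'd) measure \<Rightarrow> nat \<Rightarrow> nat \<Rightarrow> nat \<Rightarrow> nat \<Rightarrow>
    (nat \<Rightarrow> nat \<Rightarrow> nat \<Rightarrow> 'w \<Rightarrow> nat) \<Rightarrow> (nat \<Rightarrow> nat \<Rightarrow> nat \<Rightarrow> 'w \<Rightarrow> real ^ 'd ^ 'd) \<Rightarrow> bool" where
  "vr_sampling M \<nu> n T m b idx Gs \<longleftrightarrow>
     prob_space.indep_vars M (\<lambda>_. count_space {1..n} \<Otimes>\<^sub>M O_borel)
       (\<lambda>(\<tau>, k, j) \<omega>. (idx \<tau> k j \<omega>, Gs \<tau> k j \<omega>)) ({0..T} \<times> {0..<m} \<times> {1..b}) \<and>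
     (\<forall>\<tau>\<in>{0..T}. \<forall>k\<in>{0..<m}. \<forall>j\<in>{1..b}.
        distr M (count_space {1..n} \<Otimes>\<^sub>M O_borel) (\<lambda>\<omega>. (idx \<tau> k j \<omega>, Gs \<tau> k j \<omega>))
          = uniform_count_measure {1..n} \<Otimes>\<^sub>M \<nu>)"

text \<open>Expectation of \<open>F X - min F\<close>. The integrand is nonnegative, so \<^const>\<open>e2ennreal\<close> does
  not truncate; the value may be infinite.\<close>

definition expected_gap :: "'w measure \<Rightarrow> ('a \<Rightarrow> ereal) \<Rightarrow> ('w \<Rightarrow> 'a) \<Rightarrow> ennreal" where
  "expected_gap M F X = (\<integral>\<^sup>+ \<omega>. e2ennreal (F (X \<omega>) - min_value F) \<partial>M)"

end

theory Submission
  imports Defs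
begin

text \<open>
The proof has a deterministic and a probabilistic half, joined by a Lyapunov function.

\<^emph>\<open>Deterministic half.\<close> One proximal step along a direction \<open>v\<close> from the point \<open>x\<close> to \<open>x\<^sub>+\<close> satisfies
\<open>F x\<^sub>+ \<le> F x - c\<^sub>1 \<parallel>\<G> x\<parallel>\<^sup>2 - c\<^sub>2 \<parallel>x\<^sub>+ - x\<parallel>\<^sup>2 + \<gamma> / 2 \<parallel>v - \<nabla>f(x)\<parallel>\<^sup>2\<close>, where \<open>\<G>\<close> is the gradient mapping
(lemma \<open>descent_of_inexact_prox_step\<close>). The RPL inequality bounds \<open>\<parallel>\<G> x\<parallel>\<^sup>2\<close> below by the optimality
gap, and the gap contracts by \<open>\<alpha>\<close> up to the squared error of the direction.

\<^emph>\<open>Probabilistic half.\<close> If \<open>G\<close> is Haar distributed and \<open>u\<close> is a unit vector, invariance forces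
\<open>E \<langle>v, G u\<rangle> \<langle>w, G u\<rangle> = \<langle>v, w\<rangle> / d\<close> (lemma \<open>haar_second_moment\<close>). Hence \<open>d / l\<close> times the projection onto
\<open>l\<close> of the columns of \<open>G\<close> is unbiased, and it increases the mean squared norm by the factor \<open>d / l\<close>. Up to
finite-difference errors of order \<open>\<beta>\<close>, the direction at \<open>x\<close> with snapshot \<open>y\<close> is therefore an unbiased
estimator of \<open>\<nabla>f(x)\<close>, whose variance is at most \<open>(d / (l b)) L\<^sup>2 \<parallel>x - y\<parallel>\<^sup>2\<close> by independence within
the batch (lemmas \<open>batch_second_moment\<close> and \<open>direction_error\<close>).

\<^emph>\<open>Lyapunov function.\<close> The variance is controlled by adding to the gap the squared distance to the
snapshot, with a weight that decreases linearly to zero in the course of the inner loop. The smallness of \<open>\<gamma>\<close> is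
what makes this function contract by \<open>\<alpha>\<close> in each inner step, up to an error
of order \<open>\<gamma> \<beta>\<^sup>2\<close> (lemmas \<open>lyapunov_prox_step\<close> and \<open>expected_lyapunov_step\<close>). At both ends of the
inner loop it equals the gap, so that one outer iteration contracts the expected gap by \<open>\<alpha>\<^sup>m\<close> and adds a
geometric sum of errors. Unrolling the outer recursion gives the theorem. Randomness of the current
point is dealt with by conditioning: iterate and snapshot are functions of the past samples, which
are independent of the present batch.

The RPL inequality holds at every point and bounds the gap by a real number, so \<open>h\<close> has real values.
The lemmas are stated for real-valued \<open>h\<close>, which is then continuous.
\<close>

section \<open>Functions with Lipschitz gradient\<close>

lemma GDERIV_gradient:
  fixes f :: "'a::euclidean_space \<Rightarrow> real"
  assumes "f differentiable (at x)"
  shows "GDERIV f x :> gradient f x"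
proof -
  obtain f' where f': "(f has_derivative f') (at x)"
    using assms by (auto simp: differentiable_def)
  interpret bounded_linear f' using f' by (rule has_derivative_bounded_linear)
  have "f' = (\<lambda>v. v \<bullet> adjoint f' 1)"
    using adjoint_works[OF linear_axioms, of _ 1] by (simp add: fun_eq_iff)
  hence "GDERIV f x :> adjoint f' 1"
    using f' by (simp add: gderiv_def)
  moreover have "D = D'" if "GDERIV f x :> D" "GDERIV f x :> D'" for D D'
  proof -
    have "(\<lambda>h. h \<bullet> D) = (\<lambda>h. h \<bullet> D')"
      using that has_derivative_unique unfolding gderiv_def by blast
    thus ?thesis by (metis vector_eq_ldot)
  qed
  ultimately show ?thesis unfolding gradient_def by (metis theI)
qed

lemma gradient_eqI:
  fixes f :: "'a::euclidean_space \<Rightarrow> real"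
  assumes "GDERIV f x :> D"
  shows "gradient f x = D"
proof -
  have "GDERIV f x :> gradient f x"
    using assms by (intro GDERIV_gradient) (auto simp: gderiv_def differentiable_def)
  hence "(\<lambda>h. h \<bullet> D) = (\<lambda>h. h \<bullet> gradient f x)"
    using has_derivative_unique assms unfolding gderiv_def by blast
  thus ?thesis by (metis vector_eq_ldot)
qed

text \<open>The two functions \<open>t \<mapsto> s * (f (x + t v) - t \<langle>v, \<nabla>f(x)\<rangle>) - L t\<^sup>2 \<parallel>v\<parallel>\<^sup>2 / 2\<close> with \<open>s = 1\<close> and
  \<open>s = - 1\<close> are nonincreasing for \<open>t \<ge> 0\<close>, because their derivatives compare the gradients at
  \<open>x + t v\<close> and \<open>x\<close>. Comparing \<open>t = 0\<close> and \<open>t = 1\<close> gives both halves of the bound.\<close>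

lemma quadratic_bound_of_lipschitz_gradient:
  fixes f :: "'a::euclidean_space \<Rightarrow> real"
  assumes diff: "\<And>x. f differentiable (at x)"
    and lip: "\<And>x y. norm (gradient f x - gradient f y) \<le> L * norm (x - y)"
  shows "\<bar>f y - f x - (y - x) \<bullet> gradient f x\<bar> \<le> L / 2 * (norm (y - x))\<^sup>2"
proof -
  define v where "v = y - x"
  have D: "((\<lambda>t. f (x + t *\<^sub>R v)) has_real_derivative v \<bullet> gradient f (x + t *\<^sub>R v)) (at t)" for t
  proof -
    have "((\<lambda>t. x + t *\<^sub>R v) has_derivative (\<lambda>s. s *\<^sub>R v)) (at t)"
      by (auto intro!: derivative_eq_intros)
    moreover have "(f has_derivative (\<lambda>h. h \<bullet> gradient f (x + t *\<^sub>R v))) (at (x + t *\<^sub>R v))"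
      using GDERIV_gradient[OF diff] by (simp add: gderiv_def)
    ultimately have "((\<lambda>t. f (x + t *\<^sub>R v)) has_derivative (\<lambda>s. s *\<^sub>R v \<bullet> gradient f (x + t *\<^sub>R v))) (at t)"
      by (rule has_derivative_compose)
    thus ?thesis by (simp add: has_field_derivative_def mult.commute[of _ "v \<bullet> _"] mult_commute_abs)
  qed
  have grow: "\<bar>v \<bullet> (gradient f (x + t *\<^sub>R v) - gradient f x)\<bar> \<le> L * t * (norm v)\<^sup>2" if "0 \<le> t" for t
  proof -
    have "\<bar>v \<bullet> (gradient f (x + t *\<^sub>R v) - gradient f x)\<bar>
        \<le> norm v * norm (gradient f (x + t *\<^sub>R v) - gradient f x)"
      by (rule Cauchy_Schwarz_ineq2)
    also have "\<dots> \<le> norm v * (L * norm (t *\<^sub>R v))"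
      using lip[of "x + t *\<^sub>R v" x] by (intro mult_left_mono) auto
    finally show ?thesis using that by (simp add: power2_eq_square mult_ac)
  qed
  have "\<bar>f (x + 1 *\<^sub>R v) - f x - v \<bullet> gradient f x\<bar> \<le> L / 2 * (norm v)\<^sup>2"
  proof -
    define p where "p s t = s * (f (x + t *\<^sub>R v) - t * (v \<bullet> gradient f x)) - L / 2 * t\<^sup>2 * (norm v)\<^sup>2" for s t
    have "p s 1 \<le> p s 0" if s: "s \<in> {1, -1}" for s
    proof (rule DERIV_nonpos_imp_nonincreasing, simp)
      fix t :: real assume t: "0 \<le> t" "t \<le> 1"
      have "(p s has_real_derivative s * (v \<bullet> gradient f (x + t *\<^sub>R v) - v \<bullet> gradient f x)
               - L * t * (norm v)\<^sup>2) (at t)"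
        unfolding p_def by (auto intro!: derivative_eq_intros D)
      moreover have "s * (v \<bullet> gradient f (x + t *\<^sub>R v) - v \<bullet> gradient f x) - L * t * (norm v)\<^sup>2 \<le> 0"
        using grow[of t] t s by (auto simp: inner_diff_right)
      ultimately show "\<exists>D. (p s has_real_derivative D) (at t) \<and> D \<le> 0" by blast
    qed
    from this[of 1] this[of "-1"] show ?thesis by (simp add: p_def abs_if)
  qed
  thus ?thesis by (simp add: v_def)
qed

lemma GDERIV_f_avg:
  fixes f :: "nat \<Rightarrow> 'a::euclidean_space \<Rightarrow> real"
  assumes "\<And>i. i \<in> {1..n} \<Longrightarrow> f i differentiable (at x)"
  shows "GDERIV (f_avg n f) x :> (1 / real n) *\<^sub>R (\<Sum>i=1..n. gradient (f i) x)"
proof -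
  have "(f i has_derivative (\<lambda>h. h \<bullet> gradient (f i) x)) (at x)" if "i \<in> {1..n}" for i
    using GDERIV_gradient[OF assms[OF that]] by (simp add: gderiv_def)
  hence "((\<lambda>x. (1 / real n) * (\<Sum>i=1..n. f i x)) has_derivative
          (\<lambda>h. (1 / real n) * (\<Sum>i=1..n. h \<bullet> gradient (f i) x))) (at x)"
    by (intro has_derivative_mult_right has_derivative_sum) auto
  thus ?thesis
    by (simp add: gderiv_def f_avg_def[abs_def] inner_sum_right)
qed

lemma gradient_f_avg:
  fixes f :: "nat \<Rightarrow> 'a::euclidean_space \<Rightarrow> real"
  assumes "\<And>i. i \<in> {1..n} \<Longrightarrow> f i differentiable (at x)"
  shows "gradient (f_avg n f) x = (1 / real n) *\<^sub>R (\<Sum>i=1..n. gradient (f i) x)"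
  by (rule gradient_eqI, rule GDERIV_f_avg, rule assms)

lemma lipschitz_gradient_f_avg:
  fixes f :: "nat \<Rightarrow> 'a::euclidean_space \<Rightarrow> real"
  assumes n: "n \<ge> 1"
    and diff: "\<And>i x. i \<in> {1..n} \<Longrightarrow> f i differentiable (at x)"
    and lip: "\<And>i x y. i \<in> {1..n} \<Longrightarrow> norm (gradient (f i) x - gradient (f i) y) \<le> L * norm (x - y)"
  shows "norm (gradient (f_avg n f) x - gradient (f_avg n f) y) \<le> L * norm (x - y)"
proof -
  have "gradient (f_avg n f) x - gradient (f_avg n f) y
      = (1 / real n) *\<^sub>R (\<Sum>i=1..n. gradient (f i) x - gradient (f i) y)"
    by (simp only: gradient_f_avg diff sum_subtractf scaleR_right_diff_distrib)
  moreover have "norm (\<Sum>i=1..n. gradient (f i) x - gradient (f i) y) \<le> (\<Sum>i=1..n. L * norm (x - y))"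
    by (intro order.trans[OF norm_sum] sum_mono lip)
  ultimately show ?thesis using n by (simp add: field_simps)
qed

section \<open>The proximal operator\<close>

lemma prox_is_minimizer:
  fixes h :: "'a::real_inner \<Rightarrow> ereal"
  assumes "proximable h" "\<gamma> > 0"
  shows "prox_objective \<gamma> h x (prox \<gamma> h x) \<le> prox_objective \<gamma> h x z"
proof -
  have "\<exists>!y. is_arg_min (prox_objective \<gamma> h x) (\<lambda>_. True) y"
    using assms by (auto simp: proximable_def)
  hence "is_arg_min (prox_objective \<gamma> h x) (\<lambda>_. True) (prox \<gamma> h x)"
    unfolding prox_def arg_min_def by (metis someI_ex)
  thus ?thesis by (simp add: is_arg_min_linorder)
qed

lemma convex_on_of_convex_ereal:
  assumes "convex_ereal (\<lambda>x. ereal (h x))"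
  shows "convex_on UNIV h"
proof (rule convex_onI)
  fix t :: real and x y assume "0 < t" "t < 1"
  hence "ereal (h ((1 - t) *\<^sub>R x + t *\<^sub>R y)) \<le> ereal (1 - t) * ereal (h x) + ereal t * ereal (h y)"
    using assms unfolding convex_ereal_def by force
  thus "h ((1 - t) *\<^sub>R x + t *\<^sub>R y) \<le> (1 - t) * h x + t * h y" by simp
qed simp

text \<open>The first-order optimality condition of the proximal problem. The minimizer \<open>p\<close> is compared with
  the points \<open>p + t (z - p)\<close>; convexity makes the change of \<open>h\<close> linear in \<open>t\<close>, and after division by
  \<open>t\<close> the quadratic part of the change of the square is of order \<open>t\<close>.\<close>

lemma prox_variational_inequality:
  fixes h :: "'a::real_inner \<Rightarrow> real"
  assumes conv: "convex_ereal (\<lambda>x. ereal (h x))" and prox: "proximable (\<lambda>x. ereal (h x))"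
    and \<gamma>: "\<gamma> > 0" and p: "p = prox \<gamma> (\<lambda>x. ereal (h x)) x"
  shows "h p - h z \<le> 1 / \<gamma> * ((z - p) \<bullet> (p - x))"
proof (rule field_le_epsilon)
  fix \<epsilon> :: real assume \<epsilon>: "\<epsilon> > 0"
  define c where "c = 1 / (2 * \<gamma>) * (norm (z - p))\<^sup>2"
  have c: "c \<ge> 0" using \<gamma> by (simp add: c_def)
  \<comment> \<open>small enough for the leftover \<open>t * c\<close> to be below \<open>\<epsilon>\<close>; the \<open>+ 1\<close> covers \<open>z = p\<close>\<close>
  define t where "t = min 1 (\<epsilon> / (c + 1))"
  have t: "0 < t" "t \<le> 1" using \<epsilon> c by (auto simp: t_def)
  have "t * c \<le> \<epsilon> / (c + 1) * c" using c by (intro mult_right_mono) (auto simp: t_def)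
  also have "\<dots> \<le> \<epsilon>" using c \<epsilon> by (simp add: field_simps)
  finally have tc: "t * c \<le> \<epsilon>" .
  define zt where "zt = (1 - t) *\<^sub>R p + t *\<^sub>R z"
  have "ereal (h p + 1 / (2 * \<gamma>) * (norm (p - x))\<^sup>2) \<le> ereal (h zt + 1 / (2 * \<gamma>) * (norm (zt - x))\<^sup>2)"
    using prox_is_minimizer[OF prox \<gamma>, of x zt] by (simp add: prox_objective_def p)
  hence "h p + 1 / (2 * \<gamma>) * (norm (p - x))\<^sup>2 \<le> h zt + 1 / (2 * \<gamma>) * (norm (zt - x))\<^sup>2" by simp
  moreover have "h zt \<le> (1 - t) * h p + t * h z"
    using convex_onD[OF convex_on_of_convex_ereal[OF conv], of t p z] t by (simp add: zt_def)
  moreover have "(norm (zt - x))\<^sup>2 = (norm (p - x))\<^sup>2 + 2 * t * ((z - p) \<bullet> (p - x)) + t\<^sup>2 * (norm (z - p))\<^sup>2"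
    unfolding zt_def power2_norm_eq_inner
    by (simp add: algebra_simps inner_commute power2_eq_square)
  ultimately have "t * (h p - h z) \<le> 1 / (2 * \<gamma>) * (2 * t * ((z - p) \<bullet> (p - x)) + t\<^sup>2 * (norm (z - p))\<^sup>2)"
    by (simp add: algebra_simps)
  also have "\<dots> = t * (1 / \<gamma> * ((z - p) \<bullet> (p - x)) + t * c)"
    using \<gamma> by (simp add: c_def field_simps power2_eq_square)
  finally have "h p - h z \<le> 1 / \<gamma> * ((z - p) \<bullet> (p - x)) + t * c"
    using t by (simp only: mult_le_cancel_left_pos)
  with tc show "h p - h z \<le> 1 / \<gamma> * ((z - p) \<bullet> (p - x)) + \<epsilon>" by simp
qed

text \<open>Adding the optimality conditions at two points eliminates \<open>h\<close>. The resulting continuity is what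
  makes the iterates measurable functions of the samples.\<close>

lemma prox_nonexpansive:
  fixes h :: "'a::real_inner \<Rightarrow> real"
  assumes conv: "convex_ereal (\<lambda>x. ereal (h x))" and prox: "proximable (\<lambda>x. ereal (h x))"
    and \<gamma>: "\<gamma> > 0"
  shows "norm (prox \<gamma> (\<lambda>x. ereal (h x)) x - prox \<gamma> (\<lambda>x. ereal (h x)) y) \<le> norm (x - y)"
proof -
  define p q where "p = prox \<gamma> (\<lambda>x. ereal (h x)) x" and "q = prox \<gamma> (\<lambda>x. ereal (h x)) y"
  have "0 \<le> 1 / \<gamma> * ((q - p) \<bullet> (p - x)) + 1 / \<gamma> * ((p - q) \<bullet> (q - y))"
    using prox_variational_inequality[OF conv prox \<gamma> p_def, of q]
      prox_variational_inequality[OF conv prox \<gamma> q_def, of p] by linarith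
  also have "\<dots> = 1 / \<gamma> * ((p - q) \<bullet> (x - y) - (p - q) \<bullet> (p - q))"
    by (simp add: algebra_simps inner_commute)
  finally have "(norm (p - q))\<^sup>2 \<le> (p - q) \<bullet> (x - y)"
    using \<gamma> by (simp add: zero_le_mult_iff power2_norm_eq_inner zero_le_divide_iff)
  also have "\<dots> \<le> norm (p - q) * norm (x - y)" by (rule norm_cauchy_schwarz)
  finally have "norm (p - q) * norm (p - q) \<le> norm (p - q) * norm (x - y)"
    by (simp add: power2_eq_square)
  hence "norm (p - q) \<le> norm (x - y)"
    by (metis mult_le_cancel_left_pos norm_ge_zero order_le_less)
  thus ?thesis by (simp add: p_def q_def)
qed

lemma continuous_on_prox:
  fixes h :: "'a::real_inner \<Rightarrow> real"
  assumes "convex_ereal (\<lambda>x. ereal (h x))" "proximable (\<lambda>x. ereal (h x))" "\<gamma> > 0"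
  shows "continuous_on UNIV (prox \<gamma> (\<lambda>x. ereal (h x)))"
  unfolding continuous_on_iff dist_norm
  using prox_nonexpansive[OF assms] by (meson le_less_trans)

section \<open>One proximal step with an inexact gradient\<close>

text \<open>A three-point inequality for one step along an arbitrary direction \<open>v\<close>, with a free comparison
  point \<open>z\<close>. The smooth part is expanded around \<open>x\<close>, upwards towards \<open>y\<close> and downwards towards \<open>z\<close>;
  the nonsmooth part is handled by the optimality condition of \<open>y\<close>.\<close>

lemma prox_step_inequality:
  fixes f h :: "'a::euclidean_space \<Rightarrow> real"
  assumes diff: "\<And>x. f differentiable (at x)"
    and lip: "\<And>x y. norm (gradient f x - gradient f y) \<le> L * norm (x - y)"
    and conv: "convex_ereal (\<lambda>x. ereal (h x))" and prox: "proximable (\<lambda>x. ereal (h x))"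
    and \<gamma>: "\<gamma> > 0" and y: "y = prox \<gamma> (\<lambda>x. ereal (h x)) (x - \<gamma> *\<^sub>R v)"
  shows "f y + h y \<le> f z + h z + (y - z) \<bullet> (gradient f x - v)
     + (L / 2 - 1 / (2 * \<gamma>)) * (norm (y - x))\<^sup>2 + (L / 2 + 1 / (2 * \<gamma>)) * (norm (z - x))\<^sup>2
     - 1 / (2 * \<gamma>) * (norm (y - z))\<^sup>2"
proof -
  note q = quadratic_bound_of_lipschitz_gradient[OF diff lip]
  have "h y - h z \<le> 1 / \<gamma> * ((z - y) \<bullet> (y - (x - \<gamma> *\<^sub>R v)))"
    by (rule prox_variational_inequality[OF conv prox \<gamma> y])
  also have "\<dots> = 1 / \<gamma> * ((z - y) \<bullet> (y - x)) + (z - y) \<bullet> v"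
    using \<gamma> by (simp add: field_simps inner_diff_right inner_add_right)
  also have "(z - y) \<bullet> (y - x) = ((norm (z - x))\<^sup>2 - (norm (y - x))\<^sup>2 - (norm (y - z))\<^sup>2) / 2"
    unfolding power2_norm_eq_inner by (simp add: algebra_simps inner_commute)
  finally have "h y - h z \<le> 1 / (2 * \<gamma>) * ((norm (z - x))\<^sup>2 - (norm (y - x))\<^sup>2 - (norm (y - z))\<^sup>2) + (z - y) \<bullet> v"
    by simp
  moreover have "f y \<le> f x + (y - x) \<bullet> gradient f x + L / 2 * (norm (y - x))\<^sup>2"
    using q[of y x] by linarith
  moreover have "f x \<le> f z - (z - x) \<bullet> gradient f x + L / 2 * (norm (z - x))\<^sup>2"
    using q[of z x] by linarith
  ultimately show ?thesis by (simp add: algebra_simps)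
qed

text \<open>The ideal step \<open>z\<close>, taken with the true gradient, serves as intermediary: the three-point
  inequality compares \<open>z\<close> with \<open>x\<close> and then \<open>y\<close> with \<open>z\<close>. The first comparison produces the gradient
  mapping at \<open>x\<close>; in the second, Young's inequality splits the inner product of \<open>y - z\<close> with the
  gradient error so that the term in \<open>\<parallel>y - z\<parallel>\<^sup>2\<close> cancels. The ideal step thus disappears from the result.\<close>

lemma descent_of_inexact_prox_step:
  fixes f h :: "'a::euclidean_space \<Rightarrow> real"
  assumes diff: "\<And>x. f differentiable (at x)"
    and lip: "\<And>x y. norm (gradient f x - gradient f y) \<le> L * norm (x - y)"
    and conv: "convex_ereal (\<lambda>x. ereal (h x))" and prox: "proximable (\<lambda>x. ereal (h x))"
    and \<gamma>: "\<gamma> > 0" and y: "y = prox \<gamma> (\<lambda>x. ereal (h x)) (x - \<gamma> *\<^sub>R v)"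
  shows "f y + h y \<le> f x + h x
     - \<gamma>\<^sup>2 * (1 / (2 * \<gamma>) - L) * (norm (gradient_mapping \<gamma> f (\<lambda>x. ereal (h x)) x))\<^sup>2
     - (1 / (2 * \<gamma>) - L / 2) * (norm (y - x))\<^sup>2 + \<gamma> / 2 * (norm (v - gradient f x))\<^sup>2"
proof -
  define z where "z = prox \<gamma> (\<lambda>x. ereal (h x)) (x - \<gamma> *\<^sub>R gradient f x)"
  have "gradient_mapping \<gamma> f (\<lambda>x. ereal (h x)) x = (1 / \<gamma>) *\<^sub>R (x - z)"
    by (simp add: gradient_mapping_def z_def)
  hence G: "(norm (z - x))\<^sup>2 = \<gamma>\<^sup>2 * (norm (gradient_mapping \<gamma> f (\<lambda>x. ereal (h x)) x))\<^sup>2"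
    using \<gamma> by (simp add: norm_minus_commute power_divide)
  have young: "(y - z) \<bullet> w \<le> 1 / (2 * \<gamma>) * (norm (y - z))\<^sup>2 + \<gamma> / 2 * (norm w)\<^sup>2" for w
  proof -
    have "0 \<le> 1 / (2 * \<gamma>) * (norm (y - z - \<gamma> *\<^sub>R w))\<^sup>2"
      using \<gamma> by simp
    also have "(norm (y - z - \<gamma> *\<^sub>R w))\<^sup>2 = (norm (y - z))\<^sup>2 - 2 * \<gamma> * ((y - z) \<bullet> w) + \<gamma>\<^sup>2 * (norm w)\<^sup>2"
      unfolding power2_norm_eq_inner by (simp add: algebra_simps inner_commute power2_eq_square)
    also have "1 / (2 * \<gamma>) * \<dots> = 1 / (2 * \<gamma>) * (norm (y - z))\<^sup>2 - (y - z) \<bullet> w + \<gamma> / 2 * (norm w)\<^sup>2"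
      using \<gamma> by (simp add: field_simps power2_eq_square)
    finally show ?thesis by simp
  qed
  note step = prox_step_inequality[OF diff lip conv prox \<gamma>]
  have "f z + h z \<le> f x + h x + (L / 2 - 1 / (2 * \<gamma>)) * (norm (z - x))\<^sup>2 - 1 / (2 * \<gamma>) * (norm (z - x))\<^sup>2"
    using step[OF z_def, of x] by simp
  moreover have "f y + h y \<le> f z + h z + (y - z) \<bullet> (gradient f x - v)
     + (L / 2 - 1 / (2 * \<gamma>)) * (norm (y - x))\<^sup>2 + (L / 2 + 1 / (2 * \<gamma>)) * (norm (z - x))\<^sup>2
     - 1 / (2 * \<gamma>) * (norm (y - z))\<^sup>2"
    by (rule step[OF y])
  moreover have "(y - z) \<bullet> (gradient f x - v) \<le> 1 / (2 * \<gamma>) * (norm (y - z))\<^sup>2 + \<gamma> / 2 * (norm (v - gradient f x))\<^sup>2"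
    using young[of "gradient f x - v"] by (simp add: norm_minus_commute)
  ultimately have "f y + h y \<le> f x + h x + (L - 1 / (2 * \<gamma>)) * (norm (z - x))\<^sup>2
     - (1 / (2 * \<gamma>) - L / 2) * (norm (y - x))\<^sup>2 + \<gamma> / 2 * (norm (v - gradient f x))\<^sup>2"
    by (simp add: left_diff_distrib distrib_right)
  thus ?thesis unfolding G by (simp add: algebra_simps)
qed

section \<open>Finite differences along orthonormal directions\<close>

definition orthonormal_upto :: "nat \<Rightarrow> (nat \<Rightarrow> 'a::real_inner) \<Rightarrow> bool" where
  "orthonormal_upto l u \<longleftrightarrow> (\<forall>i\<in>{1..l}. \<forall>j\<in>{1..l}. u i \<bullet> u j = (if i = j then 1 else 0))"

lemma norm_sum_orthonormal:
  assumes "orthonormal_upto l u"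
  shows "(norm (\<Sum>j=1..l. c j *\<^sub>R u j))\<^sup>2 = (\<Sum>j=1..l. (c j)\<^sup>2)"
proof -
  have "(\<Sum>i=1..l. c i *\<^sub>R u i) \<bullet> (\<Sum>j=1..l. c j *\<^sub>R u j)
      = (\<Sum>i=1..l. \<Sum>j=1..l. c i * c j * (u i \<bullet> u j))"
    by (simp only: inner_sum_left) (simp add: inner_sum_right mult.assoc mult.left_commute)
  also have "\<dots> = (\<Sum>i=1..l. \<Sum>j=1..l. if i = j then c i * c j else 0)"
    using assms by (intro sum.cong refl) (auto simp: orthonormal_upto_def)
  also have "\<dots> = (\<Sum>i=1..l. (c i)\<^sup>2)"
    by (intro sum.cong refl) (simp add: power2_eq_square)
  finally show ?thesis by (simp add: power2_norm_eq_inner)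
qed

lemma orthonormal_basis_enumeration:
  fixes e :: "nat \<Rightarrow> 'a::euclidean_space"
  assumes "bij_betw e {1..D} Basis" "l \<le> D"
  shows "orthonormal_upto l e"
  unfolding orthonormal_upto_def
proof (intro ballI)
  fix i j assume "i \<in> {1..l}" "j \<in> {1..l}"
  hence ij: "i \<in> {1..D}" "j \<in> {1..D}" using assms(2) by auto
  hence "e i \<in> Basis" "e j \<in> Basis" using bij_betw_apply[OF assms(1)] by blast+
  moreover have "e i = e j \<longleftrightarrow> i = j" using bij_betw_imp_inj_on[OF assms(1)] ij by (simp add: inj_on_eq_iff)
  ultimately show "e i \<bullet> e j = (if i = j then 1 else 0)" by (simp add: inner_Basis)
qed

lemma orthonormal_image_orthogonal_matrix:
  fixes G :: "real ^ 'd ^ 'd"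
  assumes "orthogonal_matrix G" "orthonormal_upto l e"
  shows "orthonormal_upto l (\<lambda>j. G *v e j)"
proof -
  have "orthogonal_transformation (\<lambda>v. G *v v)"
    using assms(1) by (simp add: orthogonal_transformation_matrix)
  thus ?thesis using assms(2) by (simp add: orthonormal_upto_def orthogonal_transformation_def)
qed

text \<open>Each of the \<open>l\<close> directional errors is at most \<open>L \<beta> / 2\<close>. Since the directions are orthonormal the
  squared errors add up, so that the bound is linear in \<open>l\<close> where the triangle inequality would
  give \<open>l\<^sup>2\<close>.\<close>

lemma norm_fd_error:
  fixes f :: "'a::euclidean_space \<Rightarrow> real"
  assumes diff: "\<And>x. f differentiable (at x)"
    and lip: "\<And>x y. norm (gradient f x - gradient f y) \<le> L * norm (x - y)"
    and \<beta>: "\<beta> > 0" and u: "orthonormal_upto l u"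
  shows "(norm (\<Sum>j=1..l. ((f (x + \<beta> *\<^sub>R u j) - f x) / \<beta> - gradient f x \<bullet> u j) *\<^sub>R u j))\<^sup>2
      \<le> real l * (L * \<beta> / 2)\<^sup>2"
proof -
  have "((f (x + \<beta> *\<^sub>R u j) - f x) / \<beta> - gradient f x \<bullet> u j)\<^sup>2 \<le> (L * \<beta> / 2)\<^sup>2" if "j \<in> {1..l}" for j
  proof -
    have "norm (u j) = 1" using u that by (simp add: orthonormal_upto_def norm_eq_sqrt_inner)
    hence "\<bar>f (x + \<beta> *\<^sub>R u j) - f x - \<beta> * (u j \<bullet> gradient f x)\<bar> \<le> L / 2 * \<beta>\<^sup>2"
      using quadratic_bound_of_lipschitz_gradient[OF diff lip, where x = x and y = "x + \<beta> *\<^sub>R u j"] by simp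
    hence "\<bar>f (x + \<beta> *\<^sub>R u j) - f x - \<beta> * (u j \<bullet> gradient f x)\<bar> / \<beta> \<le> L / 2 * \<beta>\<^sup>2 / \<beta>"
      using \<beta> by (intro divide_right_mono) auto
    also have "\<bar>f (x + \<beta> *\<^sub>R u j) - f x - \<beta> * (u j \<bullet> gradient f x)\<bar> / \<beta>
        = \<bar>(f (x + \<beta> *\<^sub>R u j) - f x - \<beta> * (u j \<bullet> gradient f x)) / \<beta>\<bar>"
      using \<beta> by simp
    also have "(f (x + \<beta> *\<^sub>R u j) - f x - \<beta> * (u j \<bullet> gradient f x)) / \<beta>
        = (f (x + \<beta> *\<^sub>R u j) - f x) / \<beta> - gradient f x \<bullet> u j"
      using \<beta> by (simp add: field_simps inner_commute)
    also have "L / 2 * \<beta>\<^sup>2 / \<beta> = L * \<beta> / 2" using \<beta> by (simp add: power2_eq_square)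
    finally show ?thesis using power_mono[OF _ abs_ge_zero, of _ "L * \<beta> / 2" 2] by simp
  qed
  hence "(\<Sum>j=1..l. ((f (x + \<beta> *\<^sub>R u j) - f x) / \<beta> - gradient f x \<bullet> u j)\<^sup>2) \<le> (\<Sum>j=1..l. (L * \<beta> / 2)\<^sup>2)"
    by (intro sum_mono)
  thus ?thesis unfolding norm_sum_orthonormal[OF u] by simp
qed

text \<open>The limit of \<^const>\<open>fd_surrogate\<close> for \<open>\<beta> \<rightarrow> 0\<close> at a point with gradient \<open>w\<close>. For orthonormal
  directions it is \<open>d / l\<close> times the orthogonal projection of \<open>w\<close> onto a random subspace of
  dimension \<open>l\<close>.\<close>

definition random_projection ::
  "(nat \<Rightarrow> real ^ 'd) \<Rightarrow> nat \<Rightarrow> real ^ 'd ^ 'd \<Rightarrow> real ^ 'd \<Rightarrow> real ^ 'd" where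
  "random_projection e l G w =
     (real CARD('d) / real l) *\<^sub>R (\<Sum>j=1..l. (w \<bullet> (G *v e j)) *\<^sub>R (G *v e j))"

lemma random_projection_diff:
  "random_projection e l G (v - w) = random_projection e l G v - random_projection e l G w"
  by (simp add: random_projection_def inner_diff_left scaleR_left_diff_distrib sum_subtractf
      scaleR_right_diff_distrib)

lemma fd_surrogate_error:
  fixes f :: "real ^ 'd \<Rightarrow> real"
  assumes diff: "\<And>x. f differentiable (at x)"
    and lip: "\<And>x y. norm (gradient f x - gradient f y) \<le> L * norm (x - y)"
    and \<beta>: "\<beta> > 0" and e: "orthonormal_upto l e" and l: "l \<ge> 1" and L: "L \<ge> 0"
    and G: "orthogonal_matrix G"
  shows "norm (fd_surrogate e l f x G \<beta> - random_projection e l G (gradient f x))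
      \<le> real CARD('d) * L * \<beta> / (2 * sqrt (real l))"
proof -
  define S where "S = (\<Sum>j=1..l. ((f (x + \<beta> *\<^sub>R (G *v e j)) - f x) / \<beta> - gradient f x \<bullet> (G *v e j)) *\<^sub>R (G *v e j))"
  have "(norm S)\<^sup>2 \<le> real l * (L * \<beta> / 2)\<^sup>2"
    unfolding S_def
    by (rule norm_fd_error[OF diff lip \<beta> orthonormal_image_orthogonal_matrix[OF G e]])
  also have "\<dots> = (sqrt (real l) * (L * \<beta> / 2))\<^sup>2" by (simp add: power_mult_distrib power_divide)
  finally have "norm S \<le> sqrt (real l) * (L * \<beta> / 2)"
    by (rule power2_le_imp_le) (use L \<beta> in auto)
  hence "real CARD('d) / real l * norm S \<le> real CARD('d) / real l * (sqrt (real l) * (L * \<beta> / 2))"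
    by (intro mult_left_mono) auto
  also have "\<dots> = real CARD('d) * L * \<beta> / 2 * (sqrt (real l) / real l)" by (simp add: mult_ac)
  also have "sqrt (real l) / real l = 1 / sqrt (real l)"
    using l by (simp add: divide_eq_eq eq_divide_eq)
  finally have "real CARD('d) / real l * norm S \<le> real CARD('d) * L * \<beta> / (2 * sqrt (real l))" by simp
  moreover have "fd_surrogate e l f x G \<beta> - random_projection e l G (gradient f x)
      = (real CARD('d) / real l) *\<^sub>R S"
    unfolding fd_surrogate_def random_projection_def S_def
    by (simp only: scaleR_left_diff_distrib sum_subtractf scaleR_right_diff_distrib)
  ultimately show ?thesis by simp
qed

lemma fd_gradient_error:
  fixes f :: "real ^ 'd \<Rightarrow> real"
  assumes diff: "\<And>x. f differentiable (at x)"
    and lip: "\<And>x y. norm (gradient f x - gradient f y) \<le> L * norm (x - y)"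
    and \<beta>: "\<beta> > 0" and e: "bij_betw e {1..CARD('d)} Basis"
  shows "(norm (fd_gradient e f x \<beta> - gradient f x))\<^sup>2 \<le> real CARD('d) * (L * \<beta> / 2)\<^sup>2"
proof -
  have "gradient f x = (\<Sum>b\<in>Basis. (gradient f x \<bullet> b) *\<^sub>R b)" by (simp add: euclidean_representation)
  also have "\<dots> = (\<Sum>j=1..CARD('d). (gradient f x \<bullet> e j) *\<^sub>R e j)"
    using sum.reindex_bij_betw[OF e, of "\<lambda>b. (gradient f x \<bullet> b) *\<^sub>R b"] by simp
  finally have "fd_gradient e f x \<beta> - gradient f x =
      (\<Sum>j=1..CARD('d). ((f (x + \<beta> *\<^sub>R e j) - f x) / \<beta> - gradient f x \<bullet> e j) *\<^sub>R e j)"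
    unfolding fd_gradient_def by (simp only: scaleR_left_diff_distrib sum_subtractf)
  thus ?thesis
    using norm_fd_error[OF diff lip \<beta> orthonormal_basis_enumeration[OF e order_refl], of x]
    by simp
qed

section \<open>Second moments of the Haar measure\<close>

lemma measurable_O_borel_mult [measurable]:
  fixes v :: "real ^ 'd"
  shows "(\<lambda>G. G *v v) \<in> borel_measurable O_borel"
proof -
  have "continuous_on UNIV (\<lambda>G::real^'d^'d. G *v v)"
    unfolding matrix_vector_mult_def by (intro continuous_intros)
  hence "(\<lambda>G::real^'d^'d. G *v v) \<in> borel_measurable borel"
    by (rule borel_measurable_continuous_onI)
  thus ?thesis unfolding O_borel_def by (rule measurable_restrict_space1)
qed

lemma space_O_borel: "space O_borel = {Q. orthogonal_matrix Q}"
  by (simp add: O_borel_def space_restrict_space)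

lemma measurable_O_borel_left_translation:
  assumes "orthogonal_matrix (Q :: real ^ 'd ^ 'd)"
  shows "(\<lambda>X. Q ** X) \<in> measurable O_borel O_borel"
proof -
  have "continuous_on UNIV (\<lambda>X. Q ** X)"
    unfolding matrix_matrix_mult_def by (intro continuous_intros)
  hence "(\<lambda>X. Q ** X) \<in> borel_measurable borel" by (rule borel_measurable_continuous_onI)
  thus ?thesis unfolding O_borel_def
    by (intro measurable_restrict_space3) (auto intro: orthogonal_matrix_mul assms)
qed

lemma haar_translate_column:
  fixes \<phi> :: "real ^ 'd \<Rightarrow> real"
  assumes \<nu>: "haar_O \<nu>" and Q: "orthogonal_matrix Q" and \<phi>: "\<phi> \<in> borel_measurable borel"
  shows "(\<integral>G. \<phi> (Q *v (G *v v)) \<partial>\<nu>) = (\<integral>G. \<phi> (G *v v) \<partial>\<nu>)"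
proof -
  have sets: "sets \<nu> = sets O_borel" using \<nu> by (simp add: haar_O_def)
  have meas: "(\<lambda>X. Q ** X) \<in> measurable \<nu> O_borel"
    using measurable_O_borel_left_translation[OF Q] measurable_cong_sets[OF sets refl] by blast
  have "(\<integral>G. \<phi> (G *v v) \<partial>\<nu>) = (\<integral>G. \<phi> (G *v v) \<partial>distr \<nu> O_borel (\<lambda>X. Q ** X))"
    using \<nu> Q by (simp add: haar_O_def)
  also have "\<dots> = (\<integral>G. \<phi> ((Q ** G) *v v) \<partial>\<nu>)"
    by (intro integral_distr meas measurable_compose[OF measurable_O_borel_mult \<phi>])
  finally show ?thesis by (simp add: matrix_vector_mul_assoc)
qed

lemma norm_orthogonal_matrix_mult:
  fixes G :: "real ^ 'd ^ 'd"
  assumes "orthogonal_matrix G"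
  shows "norm (G *v v) = norm v"
proof -
  have "orthogonal_transformation (\<lambda>v. G *v v)"
    using assms by (simp add: orthogonal_transformation_matrix)
  thus ?thesis by (rule orthogonal_transformation_norm)
qed

lemma haar_space: "haar_O \<nu> \<Longrightarrow> G \<in> space \<nu> \<Longrightarrow> orthogonal_matrix G"
  using sets_eq_imp_space_eq[of \<nu> O_borel] by (simp add: haar_O_def space_O_borel)

lemma haar_measurable_mult: "haar_O \<nu> \<Longrightarrow> (\<lambda>G. G *v v) \<in> borel_measurable \<nu>"
  using measurable_cong_sets[of \<nu> O_borel borel borel] measurable_O_borel_mult
  by (auto simp: haar_O_def)

lemma haar_integrable_inner_mult:
  fixes u v w :: "real ^ 'd"
  assumes \<nu>: "haar_O \<nu>"
  shows "integrable \<nu> (\<lambda>G. (v \<bullet> (G *v u)) * (w \<bullet> (G *v u)))"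
proof -
  interpret prob_space \<nu> using \<nu> by (simp add: haar_O_def)
  note haar_measurable_mult[OF \<nu>, measurable]
  show ?thesis
  proof (rule integrable_const_bound[where B = "(norm v * norm u) * (norm w * norm u)"])
    show "AE G in \<nu>. norm ((v \<bullet> (G *v u)) * (w \<bullet> (G *v u))) \<le> (norm v * norm u) * (norm w * norm u)"
    proof (rule AE_I2)
      fix G assume "G \<in> space \<nu>"
      hence "norm (G *v u) = norm u" by (intro norm_orthogonal_matrix_mult haar_space[OF \<nu>])
      hence "\<bar>v \<bullet> (G *v u)\<bar> \<le> norm v * norm u" "\<bar>w \<bullet> (G *v u)\<bar> \<le> norm w * norm u"
        by (metis Cauchy_Schwarz_ineq2)+
      thus "norm ((v \<bullet> (G *v u)) * (w \<bullet> (G *v u))) \<le> (norm v * norm u) * (norm w * norm u)"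
        unfolding real_norm_def abs_mult by (intro mult_mono) auto
    qed
  qed measurable
qed

text \<open>The second moment in direction \<open>v\<close> depends on \<open>\<parallel>v\<parallel>\<close> only, since some orthogonal matrix maps \<open>v\<close>
  to any other vector of the same norm and the measure is invariant. All \<open>d\<close> coordinates of the unit
  vector \<open>G u\<close> therefore have the same second moment, and these sum up to one.\<close>

lemma haar_second_moment_diag:
  fixes u v :: "real ^ 'd"
  assumes \<nu>: "haar_O \<nu>" and u: "norm u = 1"
  shows "(\<integral>G. (v \<bullet> (G *v u))\<^sup>2 \<partial>\<nu>) = (norm v)\<^sup>2 / real CARD('d)"
proof -
  interpret prob_space \<nu> using \<nu> by (simp add: haar_O_def)
  define q where "q w = (\<integral>G. (w \<bullet> (G *v u))\<^sup>2 \<partial>\<nu>)" for w :: "real ^ 'd"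
  have q_eq: "q w = q z" if "norm w = norm z" for w z
  proof -
    obtain g where g: "orthogonal_transformation g" "g w = z"
      using orthogonal_transformation_exists \<open>norm w = norm z\<close> by metis
    define Q where "Q = matrix g"
    have Q: "orthogonal_matrix Q" "\<And>x. Q *v x = g x"
      using g(1) orthogonal_transformation_matrix[of g] matrix_works[of g]
      by (simp_all add: Q_def linear_def scalar_mult_eq_scaleR)
    have "q z = (\<integral>G. (z \<bullet> (Q *v (G *v u)))\<^sup>2 \<partial>\<nu>)"
      unfolding q_def using haar_translate_column[OF \<nu> Q(1), of "\<lambda>x. (z \<bullet> x)\<^sup>2"] by simp
    also have "\<dots> = q w"
    proof -
      have "z \<bullet> g x = w \<bullet> x" for x
        using g by (metis orthogonal_transformation_def)
      thus ?thesis by (simp only: q_def Q(2))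
    qed
    finally show ?thesis ..
  qed
  have unit: "q z = 1 / real CARD('d)" if "norm z = 1" for z
  proof -
    have "(\<Sum>i\<in>(Basis :: (real ^ 'd) set). q i) = (\<integral>G. (\<Sum>i\<in>Basis. (i \<bullet> (G *v u))\<^sup>2) \<partial>\<nu>)"
      unfolding q_def using haar_integrable_inner_mult[OF \<nu>]
      by (intro Bochner_Integration.integral_sum[symmetric]) (simp add: power2_eq_square)
    also have "\<dots> = (\<integral>G. 1 \<partial>\<nu>)"
    proof (intro Bochner_Integration.integral_cong refl)
      fix G assume "G \<in> space \<nu>"
      hence "norm (G *v u) = 1" using u by (simp add: norm_orthogonal_matrix_mult haar_space[OF \<nu>])
      thus "(\<Sum>i\<in>Basis. (i \<bullet> (G *v u))\<^sup>2) = 1"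
        using euclidean_inner[of "G *v u" "G *v u"]
        by (simp add: norm_eq_sqrt_inner inner_commute power2_eq_square)
    qed
    finally have "(\<Sum>i\<in>(Basis :: (real ^ 'd) set). q i) = 1" by (simp add: prob_space)
    moreover have "(\<Sum>i\<in>(Basis :: (real ^ 'd) set). q i) = (\<Sum>i\<in>(Basis :: (real ^ 'd) set). q z)"
      using that by (intro sum.cong refl q_eq) simp
    ultimately show ?thesis by (simp add: field_simps)
  qed
  show ?thesis
  proof (cases "v = 0")
    case False
    have "q v = (\<integral>G. (norm v)\<^sup>2 * ((v /\<^sub>R norm v) \<bullet> (G *v u))\<^sup>2 \<partial>\<nu>)"
    proof -
      have "(v \<bullet> x)\<^sup>2 = (norm v)\<^sup>2 * ((v /\<^sub>R norm v) \<bullet> x)\<^sup>2" for x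
        using False by (simp add: power_divide power_mult_distrib field_simps)
      thus ?thesis by (simp only: q_def)
    qed
    also have "\<dots> = (norm v)\<^sup>2 * q (v /\<^sub>R norm v)" unfolding q_def by simp
    finally show ?thesis using unit[of "v /\<^sub>R norm v"] False by (simp add: q_def)
  qed simp
qed

text \<open>The mixed moments follow by polarization.\<close>

lemma haar_second_moment:
  fixes u v w :: "real ^ 'd"
  assumes \<nu>: "haar_O \<nu>" and u: "norm u = 1"
  shows "(\<integral>G. (v \<bullet> (G *v u)) * (w \<bullet> (G *v u)) \<partial>\<nu>) = v \<bullet> w / real CARD('d)"
proof -
  have i: "integrable \<nu> (\<lambda>G. (z \<bullet> (G *v u))\<^sup>2)" for z
    using haar_integrable_inner_mult[OF \<nu>] by (simp add: power2_eq_square)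
  have "(\<integral>G. (v \<bullet> (G *v u)) * (w \<bullet> (G *v u)) \<partial>\<nu>)
      = (\<integral>G. (((v + w) \<bullet> (G *v u))\<^sup>2 - (v \<bullet> (G *v u))\<^sup>2 - (w \<bullet> (G *v u))\<^sup>2) / 2 \<partial>\<nu>)"
    by (intro Bochner_Integration.integral_cong refl)
       (simp add: inner_add_left power2_eq_square algebra_simps)
  also have "\<dots> = ((norm (v + w))\<^sup>2 / real CARD('d) - (norm v)\<^sup>2 / real CARD('d) - (norm w)\<^sup>2 / real CARD('d)) / 2"
    by (simp add: i haar_second_moment_diag[OF \<nu> u])
  also have "\<dots> = v \<bullet> w / real CARD('d)"
    by (simp add: dot_norm diff_divide_distrib)
  finally show ?thesis .
qed

lemma random_projection_inner:
  "random_projection e l G w \<bullet> v = real CARD('d) / real l *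
     (\<Sum>j=1..l. (w \<bullet> (G *v e j)) * (v \<bullet> (G *v e j)))" for w :: "real ^ 'd"
  unfolding random_projection_def inner_scaleR_left inner_sum_left inner_commute[of v] ..

lemma norm_random_projection:
  fixes w :: "real ^ 'd"
  assumes "orthogonal_matrix G" "orthonormal_upto l e"
  shows "(norm (random_projection e l G w))\<^sup>2 = (real CARD('d) / real l)\<^sup>2 * (\<Sum>j=1..l. (w \<bullet> (G *v e j))\<^sup>2)"
  unfolding random_projection_def norm_scaleR power_mult_distrib
    norm_sum_orthonormal[OF orthonormal_image_orthogonal_matrix[OF assms]]
  by simp

lemma norm_random_projection_le:
  fixes w :: "real ^ 'd"
  assumes G: "orthogonal_matrix G" and e: "orthonormal_upto l e" and l: "l \<ge> 1"
  shows "norm (random_projection e l G w) \<le> real CARD('d) * norm w"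
proof -
  have u: "norm (G *v e j) = 1" if "j \<in> {1..l}" for j
    using orthonormal_image_orthogonal_matrix[OF G e] that
    by (simp add: orthonormal_upto_def norm_eq_sqrt_inner)
  have "norm (\<Sum>j=1..l. (w \<bullet> (G *v e j)) *\<^sub>R (G *v e j)) \<le> (\<Sum>j=1..l. norm w)"
  proof (rule order.trans[OF norm_sum sum_mono])
    fix j assume "j \<in> {1..l}"
    thus "norm ((w \<bullet> (G *v e j)) *\<^sub>R (G *v e j)) \<le> norm w"
      using Cauchy_Schwarz_ineq2[of w "G *v e j"] by (simp add: u)
  qed
  hence "norm (\<Sum>j=1..l. (w \<bullet> (G *v e j)) *\<^sub>R (G *v e j)) \<le> real l * norm w" by simp
  hence "real CARD('d) / real l * norm (\<Sum>j=1..l. (w \<bullet> (G *v e j)) *\<^sub>R (G *v e j))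
      \<le> real CARD('d) / real l * (real l * norm w)"
    by (intro mult_left_mono) auto
  thus ?thesis using l by (simp add: random_projection_def)
qed

lemma haar_mean_random_projection_inner:
  fixes v w :: "real ^ 'd"
  assumes \<nu>: "haar_O \<nu>" and e: "orthonormal_upto l e" and l: "l \<ge> 1"
  shows "(\<integral>G. random_projection e l G w \<bullet> v \<partial>\<nu>) = w \<bullet> v"
proof -
  have u: "norm (e j) = 1" if "j \<in> {1..l}" for j
    using e that by (simp add: orthonormal_upto_def norm_eq_sqrt_inner)
  have "(\<integral>G. random_projection e l G w \<bullet> v \<partial>\<nu>) = real CARD('d) / real l *
     (\<Sum>j=1..l. (\<integral>G. (w \<bullet> (G *v e j)) * (v \<bullet> (G *v e j)) \<partial>\<nu>))"
    unfolding random_projection_inner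
    by (subst integral_mult_right_zero, subst Bochner_Integration.integral_sum)
       (auto intro: haar_integrable_inner_mult[OF \<nu>])
  also have "\<dots> = w \<bullet> v" using l by (simp add: haar_second_moment[OF \<nu> u])
  finally show ?thesis .
qed

text \<open>A projection is idempotent, so the squared norm costs a factor \<open>d / l\<close> only, and not its square.
  This is where the factor \<open>sqrt (l / d)\<close> in the admissible stepsize comes from.\<close>

lemma haar_mean_norm_random_projection:
  fixes w :: "real ^ 'd"
  assumes \<nu>: "haar_O \<nu>" and e: "orthonormal_upto l e" and l: "l \<ge> 1"
  shows "(\<integral>G. (norm (random_projection e l G w))\<^sup>2 \<partial>\<nu>) = real CARD('d) / real l * (norm w)\<^sup>2"
proof -
  have u: "norm (e j) = 1" if "j \<in> {1..l}" for j
    using e that by (simp add: orthonormal_upto_def norm_eq_sqrt_inner)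
  have "(\<integral>G. (norm (random_projection e l G w))\<^sup>2 \<partial>\<nu>)
      = (\<integral>G. (real CARD('d) / real l)\<^sup>2 * (\<Sum>j=1..l. (w \<bullet> (G *v e j))\<^sup>2) \<partial>\<nu>)"
    by (intro Bochner_Integration.integral_cong refl norm_random_projection haar_space[OF \<nu>] e)
  also have "\<dots> = (real CARD('d) / real l)\<^sup>2 * (\<Sum>j=1..l. (\<integral>G. (w \<bullet> (G *v e j))\<^sup>2 \<partial>\<nu>))"
    using haar_integrable_inner_mult[OF \<nu>]
    by (subst integral_mult_right_zero, subst Bochner_Integration.integral_sum)
       (auto simp: power2_eq_square[of "_ \<bullet> _"])
  also have "\<dots> = real CARD('d) / real l * (norm w)\<^sup>2"
    using l by (simp add: haar_second_moment_diag[OF \<nu> u] power2_eq_square[of "_ / _"])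
  finally show ?thesis .
qed

section \<open>Variance of a batch\<close>

text \<open>The mixed terms \<open>E \<langle>Y i, Y j\<rangle>\<close> vanish: coordinate by coordinate they are expectations of products
  of independent centered variables.\<close>

lemma (in prob_space) second_moment_sum_indep_centered:
  fixes Y :: "'i \<Rightarrow> 'a \<Rightarrow> 'v::euclidean_space"
  assumes fin: "finite J" and indep: "indep_vars (\<lambda>_. borel) Y J"
    and bound: "\<And>j \<omega>. j \<in> J \<Longrightarrow> \<omega> \<in> space M \<Longrightarrow> norm (Y j \<omega>) \<le> C"
    and mean: "\<And>j. j \<in> J \<Longrightarrow> expectation (Y j) = 0"
  shows "expectation (\<lambda>\<omega>. (norm (\<Sum>j\<in>J. Y j \<omega>))\<^sup>2) = (\<Sum>j\<in>J. expectation (\<lambda>\<omega>. (norm (Y j \<omega>))\<^sup>2))"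
proof -
  have meas [measurable]: "Y j \<in> borel_measurable M" if "j \<in> J" for j
    using indep that by (simp add: indep_vars_def)
  have int: "integrable M (Y j)" if "j \<in> J" for j
    using that bound by (intro integrable_const_bound[where B = C] AE_I2) auto
  have int2: "integrable M (\<lambda>\<omega>. Y i \<omega> \<bullet> Y j \<omega>)" if "i \<in> J" "j \<in> J" for i j
  proof (rule integrable_const_bound[where B = "C * C"])
    show "AE \<omega> in M. norm (Y i \<omega> \<bullet> Y j \<omega>) \<le> C * C"
    proof (rule AE_I2)
      fix \<omega> assume \<omega>: "\<omega> \<in> space M"
      have "\<bar>Y i \<omega> \<bullet> Y j \<omega>\<bar> \<le> norm (Y i \<omega>) * norm (Y j \<omega>)" by (rule Cauchy_Schwarz_ineq2)
      also have "\<dots> \<le> C * C"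
        using bound[OF that(1) \<omega>] bound[OF that(2) \<omega>] order.trans[OF norm_ge_zero bound[OF that(1) \<omega>]]
        by (intro mult_mono) auto
      finally show "norm (Y i \<omega> \<bullet> Y j \<omega>) \<le> C * C" by simp
    qed
  qed (use that in measurable)
  have cross: "expectation (\<lambda>\<omega>. Y i \<omega> \<bullet> Y j \<omega>) = 0" if ij: "i \<in> J" "j \<in> J" "i \<noteq> j" for i j
  proof -
    have prod: "expectation (\<lambda>\<omega>. (Y i \<omega> \<bullet> v) * (Y j \<omega> \<bullet> v)) = 0
        \<and> integrable M (\<lambda>\<omega>. (Y i \<omega> \<bullet> v) * (Y j \<omega> \<bullet> v))" for v
    proof -
      have ind: "indep_vars (\<lambda>_. borel) (\<lambda>k \<omega>. Y k \<omega> \<bullet> v) {i, j}"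
        using ij by (intro indep_vars_compose2[OF indep_vars_subset[OF indep]]) auto
      have iv: "integrable M (\<lambda>\<omega>. Y k \<omega> \<bullet> v)" if "k \<in> {i, j}" for k
        using that ij by (intro integrable_inner_left int) auto
      have "expectation (\<lambda>\<omega>. Y j \<omega> \<bullet> v) = expectation (Y j) \<bullet> v"
        using int[OF ij(2)] by (intro integral_inner_left) auto
      thus ?thesis
        using indep_vars_lebesgue_integral[OF _ ind iv] indep_vars_integrable[OF _ ind iv] ij mean[OF ij(2)]
        by simp
    qed
    have "expectation (\<lambda>\<omega>. Y i \<omega> \<bullet> Y j \<omega>) = (\<Sum>v\<in>Basis. expectation (\<lambda>\<omega>. (Y i \<omega> \<bullet> v) * (Y j \<omega> \<bullet> v)))"
      using prod by (subst euclidean_inner, intro Bochner_Integration.integral_sum) auto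
    thus ?thesis using prod by simp
  qed
  have "expectation (\<lambda>\<omega>. (norm (\<Sum>j\<in>J. Y j \<omega>))\<^sup>2)
      = expectation (\<lambda>\<omega>. \<Sum>i\<in>J. \<Sum>j\<in>J. Y i \<omega> \<bullet> Y j \<omega>)"
    by (simp only: power2_norm_eq_inner inner_sum_left inner_sum_right)
       (subst sum.swap, rule refl)
  also have "\<dots> = (\<Sum>i\<in>J. \<Sum>j\<in>J. expectation (\<lambda>\<omega>. Y i \<omega> \<bullet> Y j \<omega>))"
    by (simp add: int2 Bochner_Integration.integral_sum)
  also have "\<dots> = (\<Sum>i\<in>J. \<Sum>j\<in>J. if i = j then expectation (\<lambda>\<omega>. Y i \<omega> \<bullet> Y i \<omega>) else 0)"
    by (intro sum.cong refl) (auto simp: cross)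
  finally show ?thesis using fin by (simp add: power2_norm_eq_inner)
qed

locale smooth_finite_sum =
  fixes f :: "nat \<Rightarrow> real ^ 'd \<Rightarrow> real" and e :: "nat \<Rightarrow> real ^ 'd" and n b l :: nat and L :: real
  assumes n: "n \<ge> 1" and b: "b \<ge> 1" and l: "1 \<le> l" "l \<le> CARD('d)"
    and e: "bij_betw e {1..CARD('d)} Basis" and L: "L > 0"
    and diff: "\<And>i x. i \<in> {1..n} \<Longrightarrow> f i differentiable (at x)"
    and lip: "\<And>i x y. i \<in> {1..n} \<Longrightarrow> norm (gradient (f i) x - gradient (f i) y) \<le> L * norm (x - y)"
begin

abbreviation "favg \<equiv> f_avg n f"

lemma diff_favg: "favg differentiable (at x)"
  using GDERIV_f_avg[of n f x] diff by (auto simp: gderiv_def differentiable_def)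

lemma lip_favg: "norm (gradient favg x - gradient favg y) \<le> L * norm (x - y)"
  by (rule lipschitz_gradient_f_avg[OF n diff lip])

lemma e_orthonormal: "orthonormal_upto l e"
  by (rule orthonormal_basis_enumeration[OF e l(2)])

definition grad_diff :: "real ^ 'd \<Rightarrow> real ^ 'd \<Rightarrow> nat \<Rightarrow> real ^ 'd" where
  "grad_diff x y i = gradient (f i) x - gradient (f i) y"

text \<open>One sample \<open>(i, G)\<close> contributes this vector to the error of the search direction at \<open>x\<close> with
  snapshot \<open>y\<close>, apart from the finite-difference errors. It is centered, and it is small when \<open>x\<close> is
  close to \<open>y\<close>, which is the variance reduction.\<close>

definition projection_noise :: "real ^ 'd \<Rightarrow> real ^ 'd \<Rightarrow> nat \<times> (real ^ 'd ^ 'd) \<Rightarrow> real ^ 'd" where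
  "projection_noise x y s = random_projection e l (snd s) (grad_diff x y (fst s)) - (gradient favg x - gradient favg y)"

abbreviation "sample_algebra \<equiv> count_space {1..n} \<Otimes>\<^sub>M (O_borel :: (real ^ 'd ^ 'd) measure)"

lemma space_sample_algebra: "s \<in> space sample_algebra \<longleftrightarrow> fst s \<in> {1..n} \<and> orthogonal_matrix (snd s)"
  by (cases s) (simp add: space_pair_measure space_O_borel)

lemma gradient_favg_diff: "gradient favg x - gradient favg y = (1 / real n) *\<^sub>R (\<Sum>i=1..n. grad_diff x y i)"
  by (simp only: gradient_f_avg diff sum_subtractf scaleR_right_diff_distrib grad_diff_def)

lemma norm_grad_diff: "i \<in> {1..n} \<Longrightarrow> norm (grad_diff x y i) \<le> L * norm (x - y)"
  by (simp only: grad_diff_def lip)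

lemma measurable_projection_noise: "projection_noise x y \<in> borel_measurable sample_algebra"
proof -
  have [measurable]: "grad_diff x y \<in> borel_measurable (count_space {1..n})" by simp
  have [measurable]: "(\<lambda>s. snd s *v e j) \<in> borel_measurable sample_algebra" for j
    by (rule measurable_compose[OF measurable_snd measurable_O_borel_mult])
  show ?thesis unfolding projection_noise_def[abs_def] random_projection_def by measurable
qed

lemma norm_projection_noise: "s \<in> space sample_algebra \<Longrightarrow> norm (projection_noise x y s) \<le> (real CARD('d) + 1) * (L * norm (x - y))"
proof -
  assume s: "s \<in> space sample_algebra"
  have "norm (projection_noise x y s) \<le> norm (random_projection e l (snd s) (grad_diff x y (fst s))) + norm (gradient favg x - gradient favg y)"
    unfolding projection_noise_def by (rule norm_triangle_ineq4)
  also have "\<dots> \<le> real CARD('d) * norm (grad_diff x y (fst s)) + L * norm (x - y)"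
    using s by (intro add_mono norm_random_projection_le e_orthonormal l lip_favg) (simp only: space_sample_algebra)
  also have "\<dots> \<le> real CARD('d) * (L * norm (x - y)) + L * norm (x - y)"
    using s by (intro add_mono mult_left_mono norm_grad_diff order_refl) (auto simp only: space_sample_algebra of_nat_0_le_iff)
  finally show ?thesis by (simp add: algebra_simps)
qed

text \<open>Averaging over \<open>G\<close> turns the random projection into the identity, averaging over \<open>i\<close> turns the
  gradient difference of \<open>f i\<close> into that of the mean. The variance is bounded by the
  second moment of the projected gradient difference.\<close>

lemma sampling_moments:
  fixes x y :: "real ^ 'd"
  assumes \<nu>: "haar_O \<nu>"
  defines "K \<equiv> uniform_count_measure {1..n} \<Otimes>\<^sub>M \<nu>"
  shows "integral\<^sup>L K (projection_noise x y) = 0"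
    and "(\<integral>s. (norm (projection_noise x y s))\<^sup>2 \<partial>K) \<le> real CARD('d) / real l * (L * norm (x - y))\<^sup>2"
proof -
  define U where "U = uniform_count_measure {1..n}"
  interpret U: prob_space U
    unfolding U_def using n by (intro prob_space_uniform_count_measure) auto
  interpret \<nu>: prob_space \<nu> using \<nu> by (simp add: haar_O_def)
  interpret P: pair_prob_space U \<nu> ..
  note K = K_def[folded U_def]
  have sets: "sets K = sets sample_algebra"
    unfolding K U_def using \<nu>
    by (intro sets_pair_measure_cong) (auto simp: haar_O_def sets_uniform_count_measure_count_space)
  have space: "space K = space sample_algebra" by (rule sets_eq_imp_space_eq[OF sets])
  have meas: "g \<in> borel_measurable K \<longleftrightarrow> g \<in> borel_measurable sample_algebra" for g :: "_ \<Rightarrow> 'z::topological_space"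
    by (rule iffI; simp add: measurable_cong_sets[OF sets refl])
  have [measurable]: "projection_noise x y \<in> borel_measurable K" unfolding meas by (rule measurable_projection_noise)
  have intZ: "integrable K (projection_noise x y)"
    unfolding K
    by (rule P.integrable_const_bound[where B = "(real CARD('d) + 1) * (L * norm (x - y))"])
       (auto intro!: norm_projection_noise AE_I2 simp: space[unfolded K] meas[unfolded K] measurable_projection_noise simp del: One_nat_def)
  have intZ2: "integrable K (\<lambda>s. (norm (projection_noise x y s))\<^sup>2)"
    unfolding K
  proof (rule P.integrable_const_bound[where B = "((real CARD('d) + 1) * (L * norm (x - y)))\<^sup>2"])
    show "AE s in U \<Otimes>\<^sub>M \<nu>. norm ((norm (projection_noise x y s))\<^sup>2) \<le> ((real CARD('d) + 1) * (L * norm (x - y)))\<^sup>2"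
      by (rule AE_I2) (auto intro!: power_mono norm_projection_noise simp: space[unfolded K] simp del: One_nat_def)
    show "(\<lambda>s. (norm (projection_noise x y s))\<^sup>2) \<in> borel_measurable (U \<Otimes>\<^sub>M \<nu>)"
      using \<open>projection_noise x y \<in> borel_measurable K\<close> unfolding K by measurable
  qed
  have fubini: "integral\<^sup>L K g = (\<Sum>i=1..n. \<integral>G. g (i, G) \<partial>\<nu>) / real n"
    if "integrable K g" for g :: "_ \<Rightarrow> real"
  proof -
    have "integral\<^sup>L K g = (\<integral>i. \<integral>G. g (i, G) \<partial>\<nu> \<partial>U)"
      using P.integral_fst'[of g] that unfolding K by simp
    also have "\<dots> = (\<Sum>i=1..n. \<integral>G. g (i, G) \<partial>\<nu>) / real (card {1..n})"
      unfolding U_def by (rule integral_uniform_count_measure) simp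
    finally show ?thesis by simp
  qed
  define a where "a = gradient favg x - gradient favg y"
  have a: "a = (1 / real n) *\<^sub>R (\<Sum>i=1..n. grad_diff x y i)" unfolding a_def by (rule gradient_favg_diff)
  have int_proj: "integrable \<nu> (\<lambda>G. random_projection e l G w \<bullet> v)" for w v
    unfolding random_projection_inner
    by (intro integrable_mult_right Bochner_Integration.integrable_sum haar_integrable_inner_mult[OF \<nu>])
  have int_proj2: "integrable \<nu> (\<lambda>G. (norm (random_projection e l G w))\<^sup>2)" for w
  proof -
    have "integrable \<nu> (\<lambda>G. (real CARD('d) / real l)\<^sup>2 * (\<Sum>j=1..l. (w \<bullet> (G *v e j))\<^sup>2))"
      using haar_integrable_inner_mult[OF \<nu>, of w _ w] by (auto simp: power2_eq_square[of "_ \<bullet> _"])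
    thus ?thesis
      by (rule Bochner_Integration.integrable_cong[THEN iffD1, OF refl, rotated])
         (simp add: norm_random_projection[OF haar_space[OF \<nu>] e_orthonormal])
  qed
  have "integral\<^sup>L K (projection_noise x y) \<bullet> v = 0" for v
  proof -
    have "integral\<^sup>L K (projection_noise x y) \<bullet> v = (\<integral>s. projection_noise x y s \<bullet> v \<partial>K)"
      using intZ by (intro integral_inner_left[symmetric]) auto
    also have "\<dots> = (\<Sum>i=1..n. \<integral>G. projection_noise x y (i, G) \<bullet> v \<partial>\<nu>) / real n"
      using intZ by (intro fubini integrable_inner_left) auto
    also have "(\<Sum>i=1..n. \<integral>G. projection_noise x y (i, G) \<bullet> v \<partial>\<nu>) = (\<Sum>i=1..n. grad_diff x y i \<bullet> v - a \<bullet> v)"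
    proof (rule sum.cong[OF refl])
      fix i
      show "(\<integral>G. projection_noise x y (i, G) \<bullet> v \<partial>\<nu>) = grad_diff x y i \<bullet> v - a \<bullet> v"
        by (simp add: projection_noise_def a_def[symmetric] inner_diff_left int_proj \<nu>.prob_space
            haar_mean_random_projection_inner[OF \<nu> e_orthonormal l(1)])
    qed
    also have "\<dots> / real n = 0"
      using n by (simp add: a sum_subtractf inner_sum_left)
    finally show ?thesis .
  qed
  from this[of "integral\<^sup>L K (projection_noise x y)"] show "integral\<^sup>L K (projection_noise x y) = 0" by simp
  have "(\<integral>s. (norm (projection_noise x y s))\<^sup>2 \<partial>K) = (\<Sum>i=1..n. \<integral>G. (norm (projection_noise x y (i, G)))\<^sup>2 \<partial>\<nu>) / real n"
    by (rule fubini[OF intZ2])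
  also have "(\<Sum>i=1..n. \<integral>G. (norm (projection_noise x y (i, G)))\<^sup>2 \<partial>\<nu>)
      = (\<Sum>i=1..n. real CARD('d) / real l * (norm (grad_diff x y i))\<^sup>2 - 2 * (grad_diff x y i \<bullet> a) + (norm a)\<^sup>2)"
  proof (rule sum.cong[OF refl])
    fix i
    have "(\<integral>G. (norm (projection_noise x y (i, G)))\<^sup>2 \<partial>\<nu>)
        = (\<integral>G. (norm (random_projection e l G (grad_diff x y i)))\<^sup>2
               - 2 * (random_projection e l G (grad_diff x y i) \<bullet> a) + (norm a)\<^sup>2 \<partial>\<nu>)"
      by (simp add: projection_noise_def a_def[symmetric] power2_norm_eq_inner inner_diff_left inner_diff_right
          inner_commute algebra_simps)
    also have "\<dots> = real CARD('d) / real l * (norm (grad_diff x y i))\<^sup>2 - 2 * (grad_diff x y i \<bullet> a) + (norm a)\<^sup>2"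
      by (simp add: int_proj int_proj2 \<nu>.prob_space
            haar_mean_random_projection_inner[OF \<nu> e_orthonormal l(1)]
            haar_mean_norm_random_projection[OF \<nu> e_orthonormal l(1)])
    finally show "(\<integral>G. (norm (projection_noise x y (i, G)))\<^sup>2 \<partial>\<nu>) = \<dots>" .
  qed
  also have "\<dots> / real n = real CARD('d) / real l * ((\<Sum>i=1..n. (norm (grad_diff x y i))\<^sup>2) / real n) - (norm a)\<^sup>2"
  proof -
    have mean: "(\<Sum>i=1..n. grad_diff x y i \<bullet> a) = real n * (norm a)\<^sup>2"
      using n by (simp add: inner_sum_left[symmetric] power2_norm_eq_inner)
         (simp add: a)
    have split: "(\<Sum>i=1..n. c * (norm (grad_diff x y i))\<^sup>2 - 2 * (grad_diff x y i \<bullet> a) + (norm a)\<^sup>2)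
        = c * (\<Sum>i=1..n. (norm (grad_diff x y i))\<^sup>2) - 2 * (\<Sum>i=1..n. grad_diff x y i \<bullet> a) + real n * (norm a)\<^sup>2" for c
      by (simp add: sum.distrib sum_subtractf sum_distrib_left)
    show ?thesis unfolding split mean using n
      by (simp only: add_divide_distrib diff_divide_distrib) simp
  qed
  also have "\<dots> \<le> real CARD('d) / real l * ((\<Sum>i=1..n. (norm (grad_diff x y i))\<^sup>2) / real n)" by simp
  also have "\<dots> \<le> real CARD('d) / real l * ((\<Sum>i=1..n. (L * norm (x - y))\<^sup>2) / real n)"
    by (intro mult_left_mono divide_right_mono sum_mono power_mono norm_grad_diff) auto
  also have "\<dots> = real CARD('d) / real l * (L * norm (x - y))\<^sup>2" using n by simp
  finally show "(\<integral>s. (norm (projection_noise x y s))\<^sup>2 \<partial>K) \<le> real CARD('d) / real l * (L * norm (x - y))\<^sup>2" .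
qed

text \<open>The samples of a batch are independent and centered, hence the factor \<open>1 / b\<close>.\<close>

lemma batch_second_moment:
  fixes M :: "'w measure" and s :: "nat \<Rightarrow> 'w \<Rightarrow> nat \<times> (real ^ 'd ^ 'd)"
  assumes M: "prob_space M" and \<nu>: "haar_O \<nu>"
    and indep: "prob_space.indep_vars M (\<lambda>_. sample_algebra) s {1..b}"
    and law: "\<And>j. j \<in> {1..b} \<Longrightarrow> distr M sample_algebra (s j) = uniform_count_measure {1..n} \<Otimes>\<^sub>M \<nu>"
  shows "(\<integral>\<^sup>+\<omega>. ennreal ((norm ((1 / real b) *\<^sub>R (\<Sum>j=1..b. projection_noise x y (s j \<omega>))))\<^sup>2) \<partial>M)
     \<le> ennreal (real CARD('d) / (real l * real b) * (L * norm (x - y))\<^sup>2)"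
proof -
  interpret prob_space M by (rule M)
  define Y where "Y j \<omega> = projection_noise x y (s j \<omega>)" for j \<omega>
  define C where "C = (real CARD('d) + 1) * (L * norm (x - y))"
  define V where "V = real CARD('d) / real l * (L * norm (x - y))\<^sup>2"
  have C: "C \<ge> 0" using L by (simp add: C_def)
  have s [measurable]: "s j \<in> measurable M sample_algebra" if "j \<in> {1..b}" for j
    using indep that by (simp add: indep_vars_def)
  note [measurable] = measurable_projection_noise[of x y]
  have Ymeas [measurable]: "Y j \<in> borel_measurable M" if "j \<in> {1..b}" for j
    unfolding Y_def[abs_def] using that by measurable
  have Yindep: "indep_vars (\<lambda>_. borel) Y {1..b}"
    unfolding Y_def[abs_def] by (rule indep_vars_compose2[OF indep]) (rule measurable_projection_noise)
  have Ybound: "norm (Y j \<omega>) \<le> C" if "j \<in> {1..b}" "\<omega> \<in> space M" for j \<omega>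
    unfolding Y_def C_def using measurable_space[OF s] that by (intro norm_projection_noise) auto
  have Ymean: "expectation (Y j) = 0" if "j \<in> {1..b}" for j
    using integral_distr[OF s[OF that] measurable_projection_noise[of x y]] sampling_moments(1)[OF \<nu>, of x y]
    by (simp add: law[OF that] Y_def[abs_def] del: One_nat_def)
  have Yvar: "expectation (\<lambda>\<omega>. (norm (Y j \<omega>))\<^sup>2) \<le> V" if "j \<in> {1..b}" for j
  proof -
    have "(\<lambda>s. (norm (projection_noise x y s))\<^sup>2) \<in> borel_measurable sample_algebra" by measurable
    from integral_distr[OF s[OF that] this] sampling_moments(2)[OF \<nu>, of x y]
    show ?thesis by (simp add: law[OF that] Y_def[abs_def] V_def del: One_nat_def)
  qed
  have "(\<integral>\<^sup>+\<omega>. ennreal ((norm ((1 / real b) *\<^sub>R (\<Sum>j=1..b. Y j \<omega>)))\<^sup>2) \<partial>M)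
      = ennreal (expectation (\<lambda>\<omega>. (norm ((1 / real b) *\<^sub>R (\<Sum>j=1..b. Y j \<omega>)))\<^sup>2))"
  proof (intro nn_integral_eq_integral AE_I2)
    show "integrable M (\<lambda>\<omega>. (norm ((1 / real b) *\<^sub>R (\<Sum>j=1..b. Y j \<omega>)))\<^sup>2)"
    proof (rule integrable_const_bound[where B = "C\<^sup>2"])
      show "AE \<omega> in M. norm ((norm ((1 / real b) *\<^sub>R (\<Sum>j=1..b. Y j \<omega>)))\<^sup>2) \<le> C\<^sup>2"
      proof (rule AE_I2)
        fix \<omega> assume "\<omega> \<in> space M"
        hence "norm (\<Sum>j=1..b. Y j \<omega>) \<le> (\<Sum>j=1..b. C)"
          by (intro order.trans[OF norm_sum] sum_mono Ybound)
        hence "norm ((1 / real b) *\<^sub>R (\<Sum>j=1..b. Y j \<omega>)) \<le> C"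
          using b by (simp add: field_simps)
        thus "norm ((norm ((1 / real b) *\<^sub>R (\<Sum>j=1..b. Y j \<omega>)))\<^sup>2) \<le> C\<^sup>2"
          by (simp only: real_norm_def abs_power2) (rule power_mono, auto)
      qed
    qed measurable
  qed simp
  also have "expectation (\<lambda>\<omega>. (norm ((1 / real b) *\<^sub>R (\<Sum>j=1..b. Y j \<omega>)))\<^sup>2)
      = (1 / real b)\<^sup>2 * expectation (\<lambda>\<omega>. (norm (\<Sum>j=1..b. Y j \<omega>))\<^sup>2)"
    by (simp add: power_divide)
  also have "expectation (\<lambda>\<omega>. (norm (\<Sum>j=1..b. Y j \<omega>))\<^sup>2) = (\<Sum>j=1..b. expectation (\<lambda>\<omega>. (norm (Y j \<omega>))\<^sup>2))"
    by (rule second_moment_sum_indep_centered[OF _ Yindep Ybound Ymean]) auto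
  also have "ennreal ((1 / real b)\<^sup>2 * \<dots>) \<le> ennreal ((1 / real b)\<^sup>2 * (\<Sum>j=1..b. V))"
    by (intro ennreal_leI mult_left_mono sum_mono Yvar) auto
  also have "(1 / real b)\<^sup>2 * (\<Sum>j=1..b. V) = real CARD('d) / (real l * real b) * (L * norm (x - y))\<^sup>2"
    using b by (simp add: V_def power2_eq_square)
  finally show ?thesis by (simp add: Y_def)
qed

text \<open>The error of the search direction has three parts: the averaged projection noise, the
  finite-difference errors of the surrogates at \<open>x\<close> and \<open>y\<close>, and that of the coordinate-wise gradient
  at the snapshot \<open>y\<close>. The last two hold pathwise and are of order \<open>\<beta>\<close>; the factor \<open>3\<close> is the price
  for separating the squares.\<close>

lemma direction_error:
  assumes s: "\<And>j. j \<in> {1..b} \<Longrightarrow> s j \<in> space sample_algebra" and \<beta>: "\<beta> > 0"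
  shows "(norm (vr_direction e l b n f \<beta> (\<lambda>j. fst (s j)) (\<lambda>j. snd (s j)) y x - gradient favg x))\<^sup>2
     \<le> 3 * (norm ((1 / real b) *\<^sub>R (\<Sum>j=1..b. projection_noise x y (s j))))\<^sup>2
        + \<beta>\<^sup>2 * (3 * L\<^sup>2 * (real CARD('d))\<^sup>2 / real l + 3 / 4 * L\<^sup>2 * real CARD('d))"
proof -
  \<comment> \<open>\<open>A\<close>, \<open>R\<close> and \<open>S\<close> are the three parts of the error\<close>
  define D where "D z j = fd_surrogate e l (f (fst (s j))) z (snd (s j)) \<beta>
      - random_projection e l (snd (s j)) (gradient (f (fst (s j))) z)" for z j
  define \<epsilon> where "\<epsilon> = real CARD('d) * L * \<beta> / (2 * sqrt (real l))"
  define A where "A = (1 / real b) *\<^sub>R (\<Sum>j=1..b. projection_noise x y (s j))"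
  define R where "R = (1 / real b) *\<^sub>R (\<Sum>j=1..b. D x j - D y j)"
  define S where "S = fd_gradient e favg y \<beta> - gradient favg y"
  have D: "norm (D z j) \<le> \<epsilon>" if "j \<in> {1..b}" for z j
  proof -
    have i: "fst (s j) \<in> {1..n}" "orthogonal_matrix (snd (s j))" using s[OF that] unfolding space_sample_algebra by blast+
    show ?thesis unfolding D_def \<epsilon>_def
      using fd_surrogate_error[OF diff[OF i(1)] lip[OF i(1)] \<beta> e_orthonormal l(1) _ i(2)] L by simp
  qed
  have "norm (\<Sum>j=1..b. D x j - D y j) \<le> (\<Sum>j=1..b. \<epsilon> + \<epsilon>)"
    by (intro order.trans[OF norm_sum] sum_mono order.trans[OF norm_triangle_ineq4] add_mono D)
  hence "norm R \<le> 2 * \<epsilon>" using b by (simp add: R_def field_simps)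
  hence "(norm R)\<^sup>2 \<le> (2 * \<epsilon>)\<^sup>2" by (intro power_mono) auto
  also have "\<dots> = \<beta>\<^sup>2 * (L\<^sup>2 * (real CARD('d))\<^sup>2 / real l)"
    by (simp add: \<epsilon>_def power_mult_distrib power_divide)
  finally have R: "(norm R)\<^sup>2 \<le> \<beta>\<^sup>2 * (L\<^sup>2 * (real CARD('d))\<^sup>2 / real l)" .
  have S: "(norm S)\<^sup>2 \<le> \<beta>\<^sup>2 * (L\<^sup>2 * real CARD('d) / 4)"
    using fd_gradient_error[OF diff_favg lip_favg \<beta> e, of y]
    by (simp add: S_def power_mult_distrib power_divide mult_ac)
  have "A + R = (1 / real b) *\<^sub>R (\<Sum>j=1..b. projection_noise x y (s j) + (D x j - D y j))"
    by (simp only: A_def R_def sum.distrib scaleR_right_distrib)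
  also have "(\<Sum>j=1..b. projection_noise x y (s j) + (D x j - D y j))
      = (\<Sum>j=1..b. (fd_surrogate e l (f (fst (s j))) x (snd (s j)) \<beta>
                              - fd_surrogate e l (f (fst (s j))) y (snd (s j)) \<beta>)
           - (gradient favg x - gradient favg y))"
    by (intro sum.cong refl) (simp add: projection_noise_def D_def grad_diff_def random_projection_diff)
  also have "(1 / real b) *\<^sub>R \<dots> = (1 / real b) *\<^sub>R (\<Sum>j=1..b. (fd_surrogate e l (f (fst (s j))) x (snd (s j)) \<beta>
                              - fd_surrogate e l (f (fst (s j))) y (snd (s j)) \<beta>))
           - (gradient favg x - gradient favg y)"
  proof -
    have "(1 / real b) *\<^sub>R (\<Sum>j=1..b. P j - c) = (1 / real b) *\<^sub>R (\<Sum>j=1..b. P j) - c"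
      for P :: "nat \<Rightarrow> real ^ 'd" and c
      using b by (simp add: sum_subtractf scaleR_right_diff_distrib sum_constant_scaleR del: sum_constant)
    thus ?thesis .
  qed
  finally have "vr_direction e l b n f \<beta> (\<lambda>j. fst (s j)) (\<lambda>j. snd (s j)) y x - gradient favg x = A + R + S"
    by (simp add: vr_direction_def S_def)
  moreover have "(norm (A + R + S))\<^sup>2 \<le> 3 * ((norm A)\<^sup>2 + (norm R)\<^sup>2 + (norm S)\<^sup>2)"
  proof -
    have "3 * ((norm A)\<^sup>2 + (norm R)\<^sup>2 + (norm S)\<^sup>2) - (norm (A + R + S))\<^sup>2
        = (norm (A - R))\<^sup>2 + (norm (A - S))\<^sup>2 + (norm (R - S))\<^sup>2"
      unfolding power2_norm_eq_inner by (simp add: algebra_simps inner_commute)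
    also have "\<dots> \<ge> 0" by simp
    finally show ?thesis by simp
  qed
  ultimately show ?thesis using R S unfolding A_def by (simp add: algebra_simps)
qed

end

section \<open>The Lyapunov function along one inner step\<close>

text \<open>The three numerical assumptions at the end are the bounds on the stepsize, in the form in which the
  proofs use them. The last one results from the bound with the square root by squaring and
  \<open>\<theta> \<le> 1\<close>.\<close>

locale vr_szd_problem = smooth_finite_sum f e n b l L
  for f :: "nat \<Rightarrow> real ^ 'd \<Rightarrow> real" and e n b l L +
  fixes h :: "real ^ 'd \<Rightarrow> real" and m :: nat and \<gamma> \<mu> Fmin :: real
  assumes conv: "convex_ereal (\<lambda>x. ereal (h x))" and prox: "proximable (\<lambda>x. ereal (h x))"
    and m: "m \<ge> 1" and \<gamma>: "\<gamma> > 0" and \<mu>: "\<mu> > 0"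
    and Fmin: "\<And>x. Fmin \<le> f_avg n f x + h x"
    and RPL: "\<And>x. 2 * \<mu> * (f_avg n f x + h x - Fmin)
        \<le> (norm (gradient_mapping \<gamma> (f_avg n f) (\<lambda>x. ereal (h x)) x))\<^sup>2"
    and \<gamma>_L: "\<gamma> * (4 * L) \<le> 1"
    and \<gamma>_\<mu>: "\<gamma> * \<mu> * (2 * real m + 1) \<le> 2"
    and \<gamma>_batch: "100 * \<gamma>\<^sup>2 * (real m)\<^sup>2 * L\<^sup>2 * real CARD('d) \<le> real b * real l"
begin

definition gap :: "real ^ 'd \<Rightarrow> real" where
  "gap x = favg x + h x - Fmin"

definition \<alpha> :: real where "\<alpha> = 1 - \<gamma> * \<mu> / 2"

abbreviation prox_h :: "real ^ 'd \<Rightarrow> real ^ 'd" where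
  "prox_h \<equiv> prox \<gamma> (\<lambda>x. ereal (h x))"

lemma gap_nonneg: "gap x \<ge> 0"
  using Fmin[of x] by (simp add: gap_def)

lemma \<alpha>_bounds: "2 / 3 \<le> \<alpha>" "\<alpha> < 1"
proof -
  have "\<gamma> * \<mu> * 3 \<le> \<gamma> * \<mu> * (2 * real m + 1)"
    using \<gamma> \<mu> m by (intro mult_left_mono) auto
  thus "2 / 3 \<le> \<alpha>" using \<gamma>_\<mu> by (simp add: \<alpha>_def)
  show "\<alpha> < 1" using \<gamma> \<mu> by (simp add: \<alpha>_def)
qed

text \<open>The condition \<open>\<gamma> \<le> 1 / (4 L)\<close> makes \<open>1 / (2 \<gamma>) - L\<close> at least \<open>1 / (4 \<gamma>)\<close>, from which the
  RPL inequality produces the contraction factor \<open>\<alpha>\<close>, and \<open>1 / (2 \<gamma>) - L / 2\<close> at least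
  \<open>3 / (8 \<gamma>)\<close>, which becomes the coefficient of \<open>\<parallel>x\<^sub>+ - x\<parallel>\<^sup>2\<close>, the square of the step length. The latter pays
  for the growth of the distance to the snapshot.\<close>

lemma gap_prox_step:
  "gap (prox_h (x - \<gamma> *\<^sub>R v)) \<le> \<alpha> * gap x - 3 / (8 * \<gamma>) * (norm (prox_h (x - \<gamma> *\<^sub>R v) - x))\<^sup>2
     + \<gamma> / 2 * (norm (v - gradient favg x))\<^sup>2"
proof -
  define G2 where "G2 = (norm (gradient_mapping \<gamma> favg (\<lambda>x. ereal (h x)) x))\<^sup>2"
  define r2 where "r2 = (norm (prox_h (x - \<gamma> *\<^sub>R v) - x))\<^sup>2"
  have "gap (prox_h (x - \<gamma> *\<^sub>R v)) \<le> gap x - \<gamma>\<^sup>2 * (1 / (2 * \<gamma>) - L) * G2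
     - (1 / (2 * \<gamma>) - L / 2) * r2 + \<gamma> / 2 * (norm (v - gradient favg x))\<^sup>2"
    using descent_of_inexact_prox_step[OF diff_favg lip_favg conv prox \<gamma> refl, of x v]
    by (simp add: gap_def G2_def r2_def)
  moreover have "L \<le> 1 / (4 * \<gamma>)" using \<gamma>_L \<gamma> by (simp add: field_simps)
  hence L': "1 / (4 * \<gamma>) \<le> 1 / (2 * \<gamma>) - L" "3 / (8 * \<gamma>) \<le> 1 / (2 * \<gamma>) - L / 2"
    by (simp_all add: field_simps)
  have "\<gamma> * \<mu> / 2 * gap x \<le> \<gamma>\<^sup>2 * (1 / (2 * \<gamma>) - L) * G2"
  proof -
    have "\<gamma> * \<mu> / 2 * gap x = \<gamma> / 4 * (2 * \<mu> * gap x)" by simp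
    also have "\<dots> \<le> \<gamma> / 4 * G2"
      using RPL[of x] \<gamma> by (intro mult_left_mono) (simp_all add: G2_def gap_def)
    also have "\<gamma> / 4 = \<gamma>\<^sup>2 * (1 / (4 * \<gamma>))" using \<gamma> by (simp add: power2_eq_square)
    also have "\<gamma>\<^sup>2 * (1 / (4 * \<gamma>)) * G2 \<le> \<gamma>\<^sup>2 * (1 / (2 * \<gamma>) - L) * G2"
      using L' by (intro mult_right_mono mult_left_mono) (auto simp: G2_def)
    finally show ?thesis .
  qed
  moreover have "3 / (8 * \<gamma>) * r2 \<le> (1 / (2 * \<gamma>) - L / 2) * r2"
    using L' by (intro mult_right_mono) (auto simp: r2_def)
  ultimately have "gap (prox_h (x - \<gamma> *\<^sub>R v)) \<le> gap x - \<gamma> * \<mu> / 2 * gap x - 3 / (8 * \<gamma>) * r2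
      + \<gamma> / 2 * (norm (v - gradient favg x))\<^sup>2" by linarith
  thus ?thesis by (simp add: \<alpha>_def r2_def algebra_simps)
qed

text \<open>Twelve times the factor \<open>\<gamma> / 2\<close> of the squared gradient error times its variance per unit of squared
  distance to the snapshot, so that the variance term \<open>3 * \<gamma> / 2 * (L\<^sup>2 d / (l b))\<close> equals a quarter of
  this weight.\<close>

definition distance_weight :: real where
  "distance_weight = 6 * \<gamma> * L\<^sup>2 * real CARD('d) / (real l * real b)"

text \<open>The weight of the distance to the snapshot \<open>y\<close> decreases linearly with the inner iteration \<open>k\<close>, and
  the amount released in each step pays for the variance. At \<open>k = 0\<close> the distance is zero and at
  \<open>k = m\<close> the weight is zero, so that at both ends of the inner loop the Lyapunov function is the
  optimality gap itself.\<close>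

definition lyapunov :: "nat \<Rightarrow> real ^ 'd \<Rightarrow> real ^ 'd \<Rightarrow> real" where
  "lyapunov k y x = gap x + distance_weight * (real m - real k) * (norm (x - y))\<^sup>2"

lemma distance_weight_nonneg: "distance_weight \<ge> 0"
  using \<gamma> by (simp add: distance_weight_def)

lemma lyapunov_nonneg: "k \<le> m \<Longrightarrow> lyapunov k y x \<ge> 0"
  using gap_nonneg[of x] distance_weight_nonneg by (simp add: lyapunov_def)

lemma distance_weight_le: "distance_weight * (real m)\<^sup>2 \<le> 6 / 100 / \<gamma>"
proof -
  have "distance_weight * (real m)\<^sup>2 = 6 / 100 / \<gamma> * ((100 * \<gamma>\<^sup>2 * (real m)\<^sup>2 * L\<^sup>2 * real CARD('d)) / (real b * real l))"
    using \<gamma> b l by (simp add: distance_weight_def field_simps power2_eq_square)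
  also have "\<dots> \<le> 6 / 100 / \<gamma> * 1"
    using \<gamma>_batch \<gamma> b l by (intro mult_left_mono) (simp_all add: divide_le_eq)
  finally show ?thesis by simp
qed

lemma norm_add_sq_le:
  fixes u v :: "real ^ 'd"
  assumes "\<rho> > 0"
  shows "(norm (u + v))\<^sup>2 \<le> (1 + 1 / \<rho>) * (norm u)\<^sup>2 + (1 + \<rho>) * (norm v)\<^sup>2"
proof -
  have "0 \<le> 1 / \<rho> * (norm (u - \<rho> *\<^sub>R v))\<^sup>2" using assms by simp
  also have "(norm (u - \<rho> *\<^sub>R v))\<^sup>2 = (norm u)\<^sup>2 - 2 * \<rho> * (u \<bullet> v) + \<rho>\<^sup>2 * (norm v)\<^sup>2"
    unfolding power2_norm_eq_inner by (simp add: algebra_simps inner_commute power2_eq_square)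
  also have "1 / \<rho> * \<dots> = 1 / \<rho> * (norm u)\<^sup>2 - 2 * (u \<bullet> v) + \<rho> * (norm v)\<^sup>2"
    using assms by (simp add: field_simps power2_eq_square)
  finally have "2 * (u \<bullet> v) \<le> 1 / \<rho> * (norm u)\<^sup>2 + \<rho> * (norm v)\<^sup>2" by simp
  moreover have "(norm (u + v))\<^sup>2 = (norm u)\<^sup>2 + 2 * (u \<bullet> v) + (norm v)\<^sup>2"
    unfolding power2_norm_eq_inner by (simp add: algebra_simps inner_commute)
  ultimately show ?thesis by (simp add: algebra_simps)
qed

text \<open>The new distance to the snapshot is split with \<open>\<rho> = 1 / (4 m)\<close>. The part in the step length is
  absorbed by the descent, since \<open>distance_weight * m\<^sup>2 \<le> 6 / (100 \<gamma>)\<close>. In the other part the weight grows by the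
  factor \<open>1 + 1 / (4 m)\<close> and has to contract by \<open>\<alpha>\<close>; over the at most \<open>m\<close> remaining iterations
  these effects cost at most \<open>1 / 4\<close> and \<open>1 / 2\<close> of the unit by which the weight decreases. A quarter
  remains for the variance.\<close>

lemma lyapunov_prox_step:
  assumes k: "k < m"
  shows "lyapunov (Suc k) y (prox_h (x - \<gamma> *\<^sub>R v))
    \<le> \<alpha> * lyapunov k y x - distance_weight / 4 * (norm (x - y))\<^sup>2 + \<gamma> / 2 * (norm (v - gradient favg x))\<^sup>2"
proof -
  define z where "z = prox_h (x - \<gamma> *\<^sub>R v)"
  define c where "c = distance_weight * (real m - real (Suc k))"
  \<comment> \<open>the number of remaining iterations\<close>
  define j where "j = real m - real k"
  have j: "1 \<le> j" "j \<le> real m" using k by (auto simp: j_def)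
  have c: "c = distance_weight * (j - 1)" by (simp add: c_def j_def)
  have c0: "c \<ge> 0" using distance_weight_nonneg j by (simp add: c)
  have "c * (norm (z - y))\<^sup>2 \<le> c * ((1 + 4 * real m) * (norm (z - x))\<^sup>2 + (1 + 1 / (4 * real m)) * (norm (x - y))\<^sup>2)"
    using norm_add_sq_le[of "1 / (4 * real m)" "z - x" "x - y"] m c0 by (intro mult_left_mono) auto
  also have "\<dots> = c * (1 + 4 * real m) * (norm (z - x))\<^sup>2 + c * (1 + 1 / (4 * real m)) * (norm (x - y))\<^sup>2"
    by (simp add: algebra_simps)
  also have "\<dots> \<le> 3 / (8 * \<gamma>) * (norm (z - x))\<^sup>2 + (\<alpha> * (distance_weight * j) - distance_weight / 4) * (norm (x - y))\<^sup>2"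
  proof (intro add_mono mult_right_mono)
    have "(j - 1) * (1 + 4 * real m) \<le> (real m - 1) * (1 + 4 * real m)"
      using j by (intro mult_right_mono) auto
    also have "\<dots> \<le> 4 * (real m)\<^sup>2" by (simp add: algebra_simps power2_eq_square)
    finally have "distance_weight * ((j - 1) * (1 + 4 * real m)) \<le> distance_weight * (4 * (real m)\<^sup>2)"
      by (intro mult_left_mono distance_weight_nonneg)
    hence "c * (1 + 4 * real m) \<le> 4 * (distance_weight * (real m)\<^sup>2)" by (simp only: c mult_ac)
    also have "\<dots> \<le> 4 * (6 / 100 / \<gamma>)" by (intro mult_left_mono distance_weight_le) simp
    also have "\<dots> \<le> 3 / (8 * \<gamma>)" using \<gamma> by (simp add: field_simps)
    finally show "c * (1 + 4 * real m) \<le> 3 / (8 * \<gamma>)" .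
    have "\<gamma> * \<mu> / 2 * j \<le> \<gamma> * \<mu> / 2 * real m"
      using j \<gamma> \<mu> by (intro mult_left_mono) auto
    also have "\<dots> \<le> 1 / 2" using \<gamma>_\<mu> mult_pos_pos[OF \<gamma> \<mu>] by (simp add: algebra_simps)
    finally have "\<alpha> * j \<ge> j - 1 / 2" by (simp add: \<alpha>_def algebra_simps)
    moreover have "(j - 1) / (4 * real m) \<le> 1 / 4" using j m by (simp add: field_simps)
    moreover have "(j - 1) * (1 + 1 / (4 * real m)) = (j - 1) + (j - 1) / (4 * real m)"
      by (simp add: distrib_left)
    ultimately have "(j - 1) * (1 + 1 / (4 * real m)) \<le> \<alpha> * j - 1 / 4" by linarith
    hence "distance_weight * ((j - 1) * (1 + 1 / (4 * real m))) \<le> distance_weight * (\<alpha> * j - 1 / 4)"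
      by (intro mult_left_mono distance_weight_nonneg)
    thus "c * (1 + 1 / (4 * real m)) \<le> \<alpha> * (distance_weight * j) - distance_weight / 4"
      by (simp add: c mult.assoc right_diff_distrib[of distance_weight "\<alpha> * j"] mult.left_commute[of \<alpha>])
  qed auto
  finally have "c * (norm (z - y))\<^sup>2 \<le> 3 / (8 * \<gamma>) * (norm (z - x))\<^sup>2 + (\<alpha> * (distance_weight * j) - distance_weight / 4) * (norm (x - y))\<^sup>2" .
  moreover have "gap z \<le> \<alpha> * gap x - 3 / (8 * \<gamma>) * (norm (z - x))\<^sup>2 + \<gamma> / 2 * (norm (v - gradient favg x))\<^sup>2"
    unfolding z_def by (rule gap_prox_step)
  moreover have "lyapunov (Suc k) y z = gap z + c * (norm (z - y))\<^sup>2" by (simp add: lyapunov_def c_def)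
  moreover have "\<alpha> * lyapunov k y x = \<alpha> * gap x + \<alpha> * (distance_weight * j) * (norm (x - y))\<^sup>2"
    by (simp add: lyapunov_def j_def algebra_simps)
  ultimately show ?thesis unfolding z_def[symmetric] by (simp add: left_diff_distrib)
qed

text \<open>Bounds half of the coefficient of \<open>\<beta>\<^sup>2\<close> in the squared error of the search direction.\<close>

definition smoothing_error :: real where
  "smoothing_error = 3 * L\<^sup>2 * (real CARD('d))\<^sup>2 / real l + L\<^sup>2 * real CARD('d) / 2"

text \<open>The quarter of the weight left over by the pathwise step cancels against the variance of the batch.
  The points \<open>x\<close> and \<open>y\<close> are fixed here; they become random by conditioning on the past.\<close>

lemma expected_lyapunov_step:
  fixes M :: "'w measure" and s :: "nat \<Rightarrow> 'w \<Rightarrow> nat \<times> (real ^ 'd ^ 'd)"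
  assumes M: "prob_space M" and \<nu>: "haar_O \<nu>"
    and indep: "prob_space.indep_vars M (\<lambda>_. sample_algebra) s {1..b}"
    and law: "\<And>j. j \<in> {1..b} \<Longrightarrow> distr M sample_algebra (s j) = uniform_count_measure {1..n} \<Otimes>\<^sub>M \<nu>"
    and k: "k < m" and \<beta>: "\<beta> > 0"
  shows "(\<integral>\<^sup>+\<omega>. ennreal (lyapunov (Suc k) y
            (prox_h (x - \<gamma> *\<^sub>R vr_direction e l b n f \<beta> (\<lambda>j. fst (s j \<omega>)) (\<lambda>j. snd (s j \<omega>)) y x))) \<partial>M)
     \<le> ennreal (\<alpha> * lyapunov k y x + \<gamma> * \<beta>\<^sup>2 * smoothing_error)"
proof -
  interpret prob_space M by (rule M)
  define A where "A \<omega> = (norm ((1 / real b) *\<^sub>R (\<Sum>j=1..b. projection_noise x y (s j \<omega>))))\<^sup>2" for \<omega>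
  define B where "B = \<alpha> * lyapunov k y x - distance_weight / 4 * (norm (x - y))\<^sup>2 + \<gamma> * \<beta>\<^sup>2 * smoothing_error"
  have s [measurable]: "s j \<in> measurable M sample_algebra" if "j \<in> {1..b}" for j
    using indep that by (simp add: indep_vars_def)
  note [measurable] = measurable_projection_noise[of x y]
  have [measurable]: "A \<in> borel_measurable M" unfolding A_def[abs_def] by measurable
  have smoothing_error0: "smoothing_error \<ge> 0" using L by (simp add: smoothing_error_def)
  \<comment> \<open>needed to split the sum inside \<^const>\<open>ennreal\<close>, which truncates negative numbers\<close>
  have B: "B \<ge> 0"
  proof -
    have "\<alpha> * (real m - real k) \<ge> 2 / 3 * 1" using \<alpha>_bounds k by (intro mult_mono) auto
    hence "distance_weight / 4 * 1 \<le> distance_weight * (\<alpha> * (real m - real k))"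
      using mult_left_mono[of "1 / 4" "\<alpha> * (real m - real k)", OF _ distance_weight_nonneg] by simp
    hence "distance_weight / 4 * (norm (x - y))\<^sup>2 \<le> distance_weight * (\<alpha> * (real m - real k)) * (norm (x - y))\<^sup>2"
      by (intro mult_right_mono) auto
    also have "\<dots> \<le> \<alpha> * lyapunov k y x"
      using gap_nonneg[of x] \<alpha>_bounds by (simp add: lyapunov_def algebra_simps)
    finally show ?thesis using smoothing_error0 \<gamma> by (simp add: B_def)
  qed
  have pointwise: "lyapunov (Suc k) y
      (prox_h (x - \<gamma> *\<^sub>R vr_direction e l b n f \<beta> (\<lambda>j. fst (s j \<omega>)) (\<lambda>j. snd (s j \<omega>)) y x))
      \<le> B + 3 * \<gamma> / 2 * A \<omega>" if \<omega>: "\<omega> \<in> space M" for \<omega>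
  proof -
    define v where "v = vr_direction e l b n f \<beta> (\<lambda>j. fst (s j \<omega>)) (\<lambda>j. snd (s j \<omega>)) y x"
    have "(norm (v - gradient favg x))\<^sup>2 \<le> 3 * A \<omega>
        + \<beta>\<^sup>2 * (3 * L\<^sup>2 * (real CARD('d))\<^sup>2 / real l + 3 / 4 * L\<^sup>2 * real CARD('d))"
      unfolding v_def A_def using measurable_space[OF s] \<omega> by (intro direction_error \<beta>) auto
    also have "\<dots> \<le> 3 * A \<omega> + \<beta>\<^sup>2 * (2 * smoothing_error)"
      by (intro add_left_mono mult_left_mono) (simp_all add: smoothing_error_def add_mono divide_right_mono)
    finally have "\<gamma> / 2 * (norm (v - gradient favg x))\<^sup>2 \<le> \<gamma> / 2 * (3 * A \<omega> + \<beta>\<^sup>2 * (2 * smoothing_error))"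
      using \<gamma> by (intro mult_left_mono) auto
    also have "\<dots> = 3 * \<gamma> / 2 * A \<omega> + \<gamma> * \<beta>\<^sup>2 * smoothing_error" by (simp add: algebra_simps)
    finally show ?thesis using lyapunov_prox_step[OF k, of y x v] by (simp add: B_def v_def)
  qed
  have "(\<integral>\<^sup>+\<omega>. ennreal (lyapunov (Suc k) y
            (prox_h (x - \<gamma> *\<^sub>R vr_direction e l b n f \<beta> (\<lambda>j. fst (s j \<omega>)) (\<lambda>j. snd (s j \<omega>)) y x))) \<partial>M)
     \<le> (\<integral>\<^sup>+\<omega>. ennreal B + ennreal (3 * \<gamma> / 2) * ennreal (A \<omega>) \<partial>M)"
  proof (rule nn_integral_mono)
    fix \<omega> assume "\<omega> \<in> space M"
    have "A \<omega> \<ge> 0" by (simp add: A_def)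
    with ennreal_leI[OF pointwise[OF \<open>\<omega> \<in> space M\<close>]]
    show "ennreal (lyapunov (Suc k) y
            (prox_h (x - \<gamma> *\<^sub>R vr_direction e l b n f \<beta> (\<lambda>j. fst (s j \<omega>)) (\<lambda>j. snd (s j \<omega>)) y x)))
        \<le> ennreal B + ennreal (3 * \<gamma> / 2) * ennreal (A \<omega>)"
      using B \<gamma> by (simp add: ennreal_mult[symmetric])
  qed
  also have "\<dots> = ennreal B + ennreal (3 * \<gamma> / 2) * (\<integral>\<^sup>+\<omega>. ennreal (A \<omega>) \<partial>M)"
    by (simp add: nn_integral_add nn_integral_cmult emeasure_space_1)
  also have "\<dots> \<le> ennreal B + ennreal (3 * \<gamma> / 2) * ennreal (real CARD('d) / (real l * real b) * (L * norm (x - y))\<^sup>2)"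
    unfolding A_def by (intro add_left_mono mult_left_mono batch_second_moment[OF M \<nu> indep law]) auto
  also have "\<dots> = ennreal (B + 3 * \<gamma> / 2 * (real CARD('d) / (real l * real b) * (L * norm (x - y))\<^sup>2))"
    using B \<gamma> by (simp add: ennreal_mult[symmetric])
  also have "3 * \<gamma> / 2 * (real CARD('d) / (real l * real b) * (L * norm (x - y))\<^sup>2) = distance_weight / 4 * (norm (x - y))\<^sup>2"
    by (simp add: distance_weight_def power_mult_distrib mult_ac)
  finally show ?thesis by (simp add: B_def)
qed

end

section \<open>Conditioning on the past\<close>

text \<open>Conditioning in the form that the analysis needs: when \<open>U\<close> and \<open>V\<close> are independent, \<open>V\<close> may be
  integrated out with \<open>U\<close> held fixed. Integrands with values in \<^typ>\<open>ennreal\<close> avoid any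
  integrability condition on the iterates, which need not be bounded.\<close>

lemma (in prob_space) nn_integral_indep_pair:
  assumes indep: "indep_var S U T V" and \<phi>: "\<phi> \<in> borel_measurable (S \<Otimes>\<^sub>M T)"
  shows "(\<integral>\<^sup>+\<omega>. \<phi> (U \<omega>, V \<omega>) \<partial>M) = (\<integral>\<^sup>+\<omega>. (\<integral>\<^sup>+\<omega>'. \<phi> (U \<omega>, V \<omega>') \<partial>M) \<partial>M)"
proof -
  have U [measurable]: "U \<in> measurable M S" and V [measurable]: "V \<in> measurable M T"
    and law: "distr M S U \<Otimes>\<^sub>M distr M T V = distr M (S \<Otimes>\<^sub>M T) (\<lambda>\<omega>. (U \<omega>, V \<omega>))"
    using indep by (simp_all add: indep_var_distribution_eq)
  note [measurable] = \<phi>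
  interpret V: prob_space "distr M T V" by (rule prob_space_distr) (rule V)
  have "(\<integral>\<^sup>+\<omega>. \<phi> (U \<omega>, V \<omega>) \<partial>M) = (\<integral>\<^sup>+z. \<phi> z \<partial>(distr M S U \<Otimes>\<^sub>M distr M T V))"
    unfolding law by (subst nn_integral_distr) measurable
  also have "\<dots> = (\<integral>\<^sup>+u. (\<integral>\<^sup>+v. \<phi> (u, v) \<partial>distr M T V) \<partial>distr M S U)"
    by (intro V.nn_integral_fst[symmetric]) measurable
  also have "\<dots> = (\<integral>\<^sup>+\<omega>. (\<integral>\<^sup>+v. \<phi> (U \<omega>, v) \<partial>distr M T V) \<partial>M)"
    by (subst nn_integral_distr) measurable
  also have "\<dots> = (\<integral>\<^sup>+\<omega>. (\<integral>\<^sup>+\<omega>'. \<phi> (U \<omega>, V \<omega>') \<partial>M) \<partial>M)"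
    by (intro nn_integral_cong nn_integral_distr) measurable
  finally show ?thesis .
qed

lemma vr_inner_cong:
  assumes "\<And>i j. i < k \<Longrightarrow> j \<in> {1..b} \<Longrightarrow> idx i j = idx' i j \<and> Gs i j = Gs' i j"
  shows "vr_inner e l b n f h \<gamma> \<beta> idx Gs y k = vr_inner e l b n f h \<gamma> \<beta> idx' Gs' y k"
  using assms
proof (induction k)
  case (Suc k)
  have "vr_direction e l b n f \<beta> (idx k) (Gs k) y x = vr_direction e l b n f \<beta> (idx' k) (Gs' k) y x" for x
    unfolding vr_direction_def using Suc.prems[of k] by simp
  with Suc show ?case by simp
qed simp

lemma vr_szd_cong:
  assumes "\<And>t i j. t < \<tau> \<Longrightarrow> i < m \<Longrightarrow> j \<in> {1..b} \<Longrightarrow> idx t i j = idx' t i j \<and> Gs t i j = Gs' t i j"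
  shows "vr_szd e l b n f h \<gamma> \<beta> m idx Gs x0 \<tau> = vr_szd e l b n f h \<gamma> \<beta> m idx' Gs' x0 \<tau>"
  using assms
proof (induction \<tau>)
  case (Suc \<tau>)
  have "vr_inner e l b n f h \<gamma> (\<beta> \<tau>) (idx \<tau>) (Gs \<tau>) y m = vr_inner e l b n f h \<gamma> (\<beta> \<tau>) (idx' \<tau>) (Gs' \<tau>) y m" for y
    by (rule vr_inner_cong) (use Suc.prems in auto)
  with Suc show ?case by simp
qed simp

context vr_szd_problem
begin

lemma measurable_f [measurable]: "i \<in> {1..n} \<Longrightarrow> f i \<in> borel_measurable borel"
  using diff by (intro borel_measurable_continuous_onI)
    (simp add: continuous_on_eq_continuous_at differentiable_imp_continuous_within)

lemma measurable_favg [measurable]: "favg \<in> borel_measurable borel"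
  using diff_favg by (intro borel_measurable_continuous_onI)
    (simp add: continuous_on_eq_continuous_at differentiable_imp_continuous_within)

lemma measurable_prox_h [measurable]: "prox_h \<in> borel_measurable borel"
  by (rule borel_measurable_continuous_onI[OF continuous_on_prox[OF conv prox \<gamma>]])

lemma measurable_gap [measurable]: "gap \<in> borel_measurable borel"
proof -
  have [measurable]: "h \<in> borel_measurable borel"
    by (rule borel_measurable_continuous_onI[OF convex_on_continuous[OF open_UNIV convex_on_of_convex_ereal[OF conv]]])
  show ?thesis unfolding gap_def[abs_def] by measurable
qed

lemma measurable_lyapunov:
  assumes [measurable]: "Y \<in> borel_measurable S" "X \<in> borel_measurable S"
  shows "(\<lambda>\<omega>. lyapunov k (Y \<omega>) (X \<omega>)) \<in> borel_measurable S"
  unfolding lyapunov_def by measurable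

lemma measurable_vr_direction:
  assumes s: "\<And>j. j \<in> {1..b} \<Longrightarrow> s j \<in> measurable S sample_algebra"
    and [measurable]: "Y \<in> borel_measurable S" "X \<in> borel_measurable S"
  shows "(\<lambda>\<omega>. vr_direction e l b n f \<beta> (\<lambda>j. fst (s j \<omega>)) (\<lambda>j. snd (s j \<omega>)) (Y \<omega>) (X \<omega>)) \<in> borel_measurable S"
proof -
  have surrogate: "(\<lambda>\<omega>. fd_surrogate e l (f (fst (s j \<omega>))) (W \<omega>) (snd (s j \<omega>)) \<beta>) \<in> borel_measurable S"
    if j: "j \<in> {1..b}" and [measurable]: "W \<in> borel_measurable S" for j W
  proof (rule measurable_compose_countable'[where I = "{1..n}" and g = "\<lambda>\<omega>. fst (s j \<omega>)"])
    fix i assume i [measurable]: "i \<in> {1..n}"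
    note [measurable] = measurable_f[OF i]
    have [measurable]: "(\<lambda>\<omega>. snd (s j \<omega>) *v e k) \<in> borel_measurable S" for k
      by (rule measurable_compose[OF measurable_compose[OF s[OF j] measurable_snd] measurable_O_borel_mult])
    show "(\<lambda>\<omega>. fd_surrogate e l (f i) (W \<omega>) (snd (s j \<omega>)) \<beta>) \<in> borel_measurable S"
      unfolding fd_surrogate_def by measurable
  next
    show "(\<lambda>\<omega>. fst (s j \<omega>)) \<in> measurable S (count_space {1..n})"
      by (rule measurable_compose[OF s[OF j] measurable_fst])
  qed simp
  note [measurable] = surrogate
  show ?thesis unfolding vr_direction_def fd_gradient_def by measurable
qed

lemma measurable_vr_inner:
  assumes s: "\<And>i j. i < k \<Longrightarrow> j \<in> {1..b} \<Longrightarrow> s i j \<in> measurable S sample_algebra"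
    and Y: "Y \<in> borel_measurable S"
  shows "(\<lambda>\<omega>. vr_inner e l b n f (\<lambda>x. ereal (h x)) \<gamma> \<beta> (\<lambda>i j. fst (s i j \<omega>)) (\<lambda>i j. snd (s i j \<omega>)) (Y \<omega>) k)
    \<in> borel_measurable S"
  using s
proof (induction k)
  case 0
  show ?case using Y by simp
next
  case (Suc k)
  have [measurable]: "(\<lambda>\<omega>. vr_inner e l b n f (\<lambda>x. ereal (h x)) \<gamma> \<beta> (\<lambda>i j. fst (s i j \<omega>)) (\<lambda>i j. snd (s i j \<omega>)) (Y \<omega>) k)
      \<in> borel_measurable S"
    by (rule Suc.IH) (use Suc.prems in auto)
  have [measurable]: "(\<lambda>\<omega>. vr_direction e l b n f \<beta> (\<lambda>j. fst (s k j \<omega>)) (\<lambda>j. snd (s k j \<omega>)) (Y \<omega>)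
      (vr_inner e l b n f (\<lambda>x. ereal (h x)) \<gamma> \<beta> (\<lambda>i j. fst (s i j \<omega>)) (\<lambda>i j. snd (s i j \<omega>)) (Y \<omega>) k))
      \<in> borel_measurable S"
    by (rule measurable_vr_direction) (use Suc.prems Y in auto)
  show ?case by (simp add: Let_def)
qed

lemma measurable_vr_szd:
  assumes s: "\<And>t i j. t < \<tau> \<Longrightarrow> i < m \<Longrightarrow> j \<in> {1..b} \<Longrightarrow> s t i j \<in> measurable S sample_algebra"
  shows "(\<lambda>\<omega>. vr_szd e l b n f (\<lambda>x. ereal (h x)) \<gamma> \<beta> m (\<lambda>t i j. fst (s t i j \<omega>)) (\<lambda>t i j. snd (s t i j \<omega>)) x0 \<tau>)
    \<in> borel_measurable S"
  using s
proof (induction \<tau>)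
  case (Suc \<tau>)
  show ?case unfolding vr_szd.simps
    by (rule measurable_vr_inner[OF _ Suc.IH]) (use Suc.prems in auto)
qed simp

end

section \<open>Expected decrease over inner and outer iterations\<close>

text \<open>A run of the algorithm. All samples form one family \<open>s\<close> over triples of outer, inner and batch
  index, so that the past of an inner iteration is a set of triples.\<close>

locale vr_szd_run = vr_szd_problem f e n b l L h m \<gamma> \<mu> Fmin + prob_space M
  for f :: "nat \<Rightarrow> real ^ 'd \<Rightarrow> real" and e n b l L h m \<gamma> \<mu> Fmin and M :: "'w measure" +
  fixes \<nu> :: "(real ^ 'd ^ 'd) measure" and T :: nat
    and s :: "nat \<times> nat \<times> nat \<Rightarrow> 'w \<Rightarrow> nat \<times> (real ^ 'd ^ 'd)"
    and \<beta> :: "nat \<Rightarrow> real" and x0 :: "real ^ 'd"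
  assumes \<nu>: "haar_O \<nu>" and \<beta>: "\<And>t. \<beta> t > 0"
    and indep: "indep_vars (\<lambda>_. count_space {1..n} \<Otimes>\<^sub>M O_borel) s ({0..T} \<times> {0..<m} \<times> {1..b})"
    and law: "\<And>t k j. t \<le> T \<Longrightarrow> k < m \<Longrightarrow> j \<in> {1..b} \<Longrightarrow>
        distr M (count_space {1..n} \<Otimes>\<^sub>M O_borel) (s (t, k, j)) = uniform_count_measure {1..n} \<Otimes>\<^sub>M \<nu>"
begin

text \<open>Snapshots and inner iterates as functions of a deterministic family \<open>p\<close> of samples. Their independence of
  the present batch can then be expressed by restricting \<open>p\<close> to the past.\<close>

definition snapshot_of :: "(nat \<times> nat \<times> nat \<Rightarrow> nat \<times> (real ^ 'd ^ 'd)) \<Rightarrow> nat \<Rightarrow> real ^ 'd" where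
  "snapshot_of p t = vr_szd e l b n f (\<lambda>x. ereal (h x)) \<gamma> \<beta> m
     (\<lambda>t i j. fst (p (t, i, j))) (\<lambda>t i j. snd (p (t, i, j))) x0 t"

definition iterate_of :: "(nat \<times> nat \<times> nat \<Rightarrow> nat \<times> (real ^ 'd ^ 'd)) \<Rightarrow> nat \<Rightarrow> nat \<Rightarrow> real ^ 'd" where
  "iterate_of p t k = vr_inner e l b n f (\<lambda>x. ereal (h x)) \<gamma> (\<beta> t)
     (\<lambda>i j. fst (p (t, i, j))) (\<lambda>i j. snd (p (t, i, j))) (snapshot_of p t) k"

abbreviation "snapshot t \<omega> \<equiv> snapshot_of (\<lambda>i. s i \<omega>) t"
abbreviation "iterate t k \<omega> \<equiv> iterate_of (\<lambda>i. s i \<omega>) t k"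

definition past :: "nat \<Rightarrow> nat \<Rightarrow> (nat \<times> nat \<times> nat) set" where
  "past t k = {(t', i, j). j \<in> {1..b} \<and> i < m \<and> (t' < t \<or> t' = t \<and> i < k)}"

definition present :: "nat \<Rightarrow> nat \<Rightarrow> (nat \<times> nat \<times> nat) set" where
  "present t k = {t} \<times> {k} \<times> {1..b}"

lemma iterate_0: "iterate_of p t 0 = snapshot_of p t"
  by (simp add: iterate_of_def)

lemma iterate_m: "iterate_of p t m = snapshot_of p (Suc t)"
  by (simp add: iterate_of_def snapshot_of_def)

lemma iterate_Suc:
  "iterate_of p t (Suc k) = prox_h (iterate_of p t k - \<gamma> *\<^sub>R vr_direction e l b n f (\<beta> t)
      (\<lambda>j. fst (p (t, k, j))) (\<lambda>j. snd (p (t, k, j))) (snapshot_of p t) (iterate_of p t k))"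
  by (simp add: iterate_of_def Let_def)

lemma snapshot_restrict: "snapshot_of (restrict p (past t k)) t = snapshot_of p t"
  unfolding snapshot_of_def by (rule vr_szd_cong) (auto simp: past_def)

lemma iterate_restrict: "k \<le> m \<Longrightarrow> iterate_of (restrict p (past t k)) t k = iterate_of p t k"
  unfolding iterate_of_def snapshot_restrict by (rule vr_inner_cong) (auto simp: past_def)

lemma measurable_snapshot_of: "(\<lambda>p. snapshot_of p t) \<in> borel_measurable (PiM (past t k) (\<lambda>_. sample_algebra))"
  unfolding snapshot_of_def
  by (rule measurable_vr_szd, rule measurable_component_singleton) (auto simp: past_def)

lemma measurable_iterate_of:
  "k \<le> m \<Longrightarrow> (\<lambda>p. iterate_of p t k) \<in> borel_measurable (PiM (past t k) (\<lambda>_. sample_algebra))"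
  unfolding iterate_of_def
  by (rule measurable_vr_inner[OF _ measurable_snapshot_of], rule measurable_component_singleton)
     (auto simp: past_def)

text \<open>The snapshot and the current iterate are functions of the past samples, the new direction involves the
  present batch in addition, and the two groups of samples are independent. Integrating over the
  present batch first reduces the claim to fixed points.\<close>

lemma expected_lyapunov_inner_step:
  assumes t: "t \<le> T" and k: "k < m"
  shows "(\<integral>\<^sup>+\<omega>. ennreal (lyapunov (Suc k) (snapshot t \<omega>) (iterate t (Suc k) \<omega>)) \<partial>M)
     \<le> (\<integral>\<^sup>+\<omega>. ennreal (\<alpha> * lyapunov k (snapshot t \<omega>) (iterate t k \<omega>) + \<gamma> * (\<beta> t)\<^sup>2 * smoothing_error) \<partial>M)"
proof -
  let ?A = "past t k" and ?B = "present t k"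
  define dir where "dir p q = vr_direction e l b n f (\<beta> t)
      (\<lambda>j. fst (q (t, k, j))) (\<lambda>j. snd (q (t, k, j))) (snapshot_of p t) (iterate_of p t k)" for p q
  define \<phi> where "\<phi> = (\<lambda>(p, q). ennreal (lyapunov (Suc k) (snapshot_of p t)
      (prox_h (iterate_of p t k - \<gamma> *\<^sub>R dir p q))))"
  define U where "U \<omega> = restrict (\<lambda>i. s i \<omega>) ?A" for \<omega>
  define V where "V \<omega> = restrict (\<lambda>i. s i \<omega>) ?B" for \<omega>
  have ind: "indep_var (PiM ?A (\<lambda>_. sample_algebra)) U (PiM ?B (\<lambda>_. sample_algebra)) V"
    unfolding U_def V_def using t k
    by (intro indep_var_restrict[OF indep]) (auto simp: past_def present_def)
  have snap [measurable]: "(\<lambda>z. snapshot_of (fst z) t) \<in> borel_measurable (PiM ?A (\<lambda>_. sample_algebra) \<Otimes>\<^sub>M PiM ?B (\<lambda>_. sample_algebra))"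
    by (rule measurable_compose[OF measurable_fst measurable_snapshot_of])
  have iter [measurable]: "(\<lambda>z. iterate_of (fst z) t k) \<in> borel_measurable (PiM ?A (\<lambda>_. sample_algebra) \<Otimes>\<^sub>M PiM ?B (\<lambda>_. sample_algebra))"
    by (rule measurable_compose[OF measurable_fst measurable_iterate_of]) (use k in simp)
  have [measurable]: "(\<lambda>z. dir (fst z) (snd z)) \<in> borel_measurable (PiM ?A (\<lambda>_. sample_algebra) \<Otimes>\<^sub>M PiM ?B (\<lambda>_. sample_algebra))"
    unfolding dir_def
    by (rule measurable_vr_direction[OF _ snap iter], rule measurable_compose[OF measurable_snd],
        rule measurable_component_singleton) (auto simp: present_def)
  have \<phi>: "\<phi> \<in> borel_measurable (PiM ?A (\<lambda>_. sample_algebra) \<Otimes>\<^sub>M PiM ?B (\<lambda>_. sample_algebra))"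
    unfolding \<phi>_def case_prod_beta
    by (rule measurable_compose[OF measurable_lyapunov measurable_ennreal]) measurable
  have dir_restrict: "dir p (restrict q ?B) = dir p q" for p q
    unfolding dir_def vr_direction_def by (simp add: present_def)
  have restrict: "\<phi> (U \<omega>, V \<omega>') = ennreal (lyapunov (Suc k) (snapshot t \<omega>)
      (prox_h (iterate t k \<omega> - \<gamma> *\<^sub>R dir (\<lambda>i. s i \<omega>) (\<lambda>i. s i \<omega>'))))" for \<omega> \<omega>'
    using k unfolding \<phi>_def U_def V_def case_prod_conv dir_restrict
    by (simp add: dir_def snapshot_restrict iterate_restrict)
  have ind_batch: "indep_vars (\<lambda>_. sample_algebra) (\<lambda>j. s (t, k, j)) {1..b}"
  proof -
    have "indep_vars (\<lambda>j. PiM {(t, k, j)} (\<lambda>_. sample_algebra)) (\<lambda>j \<omega>. restrict (\<lambda>i. s i \<omega>) {(t, k, j)}) {1..b}"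
      using t k by (intro indep_vars_restrict[OF indep]) (auto simp: disjoint_family_on_def)
    from indep_vars_compose2[OF this, of "\<lambda>j p. p (t, k, j)" "\<lambda>_. sample_algebra"] show ?thesis
      by (simp add: measurable_component_singleton del: One_nat_def)
  qed
  have "(\<integral>\<^sup>+\<omega>. ennreal (lyapunov (Suc k) (snapshot t \<omega>) (iterate t (Suc k) \<omega>)) \<partial>M) = (\<integral>\<^sup>+\<omega>. \<phi> (U \<omega>, V \<omega>) \<partial>M)"
    unfolding restrict dir_def iterate_Suc ..
  also have "\<dots> = (\<integral>\<^sup>+\<omega>. (\<integral>\<^sup>+\<omega>'. \<phi> (U \<omega>, V \<omega>') \<partial>M) \<partial>M)"
    by (rule nn_integral_indep_pair[OF ind \<phi>])
  also have "\<dots> \<le> (\<integral>\<^sup>+\<omega>. ennreal (\<alpha> * lyapunov k (snapshot t \<omega>) (iterate t k \<omega>) + \<gamma> * (\<beta> t)\<^sup>2 * smoothing_error) \<partial>M)"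
    unfolding restrict dir_def
    by (intro nn_integral_mono expected_lyapunov_step[OF prob_space_axioms \<nu> ind_batch law[OF t k] k \<beta>])
  finally show ?thesis .
qed

lemma measurable_samples: "t \<le> T \<Longrightarrow> i < m \<Longrightarrow> j \<in> {1..b} \<Longrightarrow> s (t, i, j) \<in> measurable M sample_algebra"
  using indep by (auto simp: indep_vars_def)

lemma measurable_snapshot: "t \<le> Suc T \<Longrightarrow> snapshot t \<in> borel_measurable M"
  unfolding snapshot_of_def by (intro measurable_vr_szd measurable_samples) auto

lemma measurable_iterate: "t \<le> T \<Longrightarrow> k \<le> m \<Longrightarrow> iterate t k \<in> borel_measurable M"
  unfolding iterate_of_def by (intro measurable_vr_inner measurable_snapshot measurable_samples) auto

lemma smoothing_error_nonneg: "smoothing_error \<ge> 0"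
  using L by (simp add: smoothing_error_def)

text \<open>Carrying a real upper bound \<open>r\<close> for the expectation along shows at the same time that the
  expectation is finite.\<close>

lemma expected_lyapunov_inner_loop:
  assumes t: "t \<le> T" and k: "k \<le> m" and r: "r \<ge> 0"
    and start: "(\<integral>\<^sup>+\<omega>. ennreal (gap (snapshot t \<omega>)) \<partial>M) \<le> ennreal r"
  shows "(\<integral>\<^sup>+\<omega>. ennreal (lyapunov k (snapshot t \<omega>) (iterate t k \<omega>)) \<partial>M)
     \<le> ennreal (\<alpha> ^ k * r + (\<Sum>i<k. \<alpha> ^ i) * (\<gamma> * (\<beta> t)\<^sup>2 * smoothing_error))"
  using k
proof (induction k)
  case 0
  thus ?case using start by (simp add: lyapunov_def iterate_0)
next
  case (Suc k)
  define K where "K = \<gamma> * (\<beta> t)\<^sup>2 * smoothing_error"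
  define R where "R = \<alpha> ^ k * r + (\<Sum>i<k. \<alpha> ^ i) * K"
  have K: "K \<ge> 0" using smoothing_error_nonneg \<gamma> by (simp add: K_def)
  have \<alpha>0: "\<alpha> \<ge> 0" using \<alpha>_bounds by simp
  have R: "R \<ge> 0" using K r \<alpha>0 by (simp add: R_def sum_nonneg)
  have [measurable]: "(\<lambda>\<omega>. lyapunov k (snapshot t \<omega>) (iterate t k \<omega>)) \<in> borel_measurable M"
    using t Suc.prems by (intro measurable_lyapunov measurable_snapshot measurable_iterate) auto
  have "(\<integral>\<^sup>+\<omega>. ennreal (lyapunov (Suc k) (snapshot t \<omega>) (iterate t (Suc k) \<omega>)) \<partial>M)
     \<le> (\<integral>\<^sup>+\<omega>. ennreal (\<alpha> * lyapunov k (snapshot t \<omega>) (iterate t k \<omega>) + K) \<partial>M)"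
    unfolding K_def using Suc.prems by (intro expected_lyapunov_inner_step t) auto
  also have "\<dots> = (\<integral>\<^sup>+\<omega>. ennreal \<alpha> * ennreal (lyapunov k (snapshot t \<omega>) (iterate t k \<omega>)) + ennreal K \<partial>M)"
    using K \<alpha>0 lyapunov_nonneg[of k] Suc.prems by (simp add: ennreal_mult ennreal_plus)
  also have "\<dots> = ennreal \<alpha> * (\<integral>\<^sup>+\<omega>. ennreal (lyapunov k (snapshot t \<omega>) (iterate t k \<omega>)) \<partial>M) + ennreal K"
    by (simp add: nn_integral_add nn_integral_cmult emeasure_space_1)
  also have "\<dots> \<le> ennreal \<alpha> * ennreal R + ennreal K"
    using Suc unfolding R_def K_def by (intro add_right_mono mult_left_mono) auto
  also have "\<dots> = ennreal (\<alpha> * R + K)" using K \<alpha>0 R by (simp add: ennreal_mult ennreal_plus)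
  also have "\<alpha> * R + K = \<alpha> ^ Suc k * r + (\<Sum>i<Suc k. \<alpha> ^ i) * K"
  proof -
    have "(\<Sum>i<Suc k. \<alpha> ^ i) = 1 + \<alpha> * (\<Sum>i<k. \<alpha> ^ i)"
      by (simp only: sum.lessThan_Suc_shift power_Suc sum_distrib_left power_0)
    thus ?thesis by (simp add: R_def algebra_simps)
  qed
  finally show ?case by (simp only: K_def)
qed

lemma expected_gap_outer_step:
  assumes t: "t \<le> T" and r: "r \<ge> 0"
    and start: "(\<integral>\<^sup>+\<omega>. ennreal (gap (snapshot t \<omega>)) \<partial>M) \<le> ennreal r"
  shows "(\<integral>\<^sup>+\<omega>. ennreal (gap (snapshot (Suc t) \<omega>)) \<partial>M)
     \<le> ennreal (\<alpha> ^ m * r + (1 - \<alpha> ^ m) / (1 - \<alpha>) * (\<gamma> * (\<beta> t)\<^sup>2 * smoothing_error))"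
proof -
  have "(\<Sum>i<m. \<alpha> ^ i) = (1 - \<alpha> ^ m) / (1 - \<alpha>)"
    using \<alpha>_bounds by (simp add: sum_gp_strict)
  thus ?thesis
    using expected_lyapunov_inner_loop[OF t order_refl r start] by (simp add: lyapunov_def iterate_m)
qed

text \<open>The closed form of the recursion \<open>r (t + 1) = \<alpha>\<^sup>m r t + c (\<beta> t)\<^sup>2\<close>, started at the gap of the
  deterministic point \<open>x0\<close>.\<close>

lemma expected_gap_bound:
  assumes "t \<le> Suc T"
  shows "(\<integral>\<^sup>+\<omega>. ennreal (gap (snapshot t \<omega>)) \<partial>M) \<le> ennreal (\<alpha> ^ (m * t) *
     (gap x0 + (1 - \<alpha> ^ m) / (1 - \<alpha>) * \<gamma> * smoothing_error * (\<Sum>i<t. (\<beta> i)\<^sup>2 / \<alpha> ^ (m * (i + 1)))))"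
  using assms
proof (induction t)
  case 0
  show ?case by (simp add: snapshot_of_def emeasure_space_1)
next
  case (Suc t)
  define c where "c = (1 - \<alpha> ^ m) / (1 - \<alpha>) * \<gamma> * smoothing_error"
  define r where "r = \<alpha> ^ (m * t) * (gap x0 + c * (\<Sum>i<t. (\<beta> i)\<^sup>2 / \<alpha> ^ (m * (i + 1))))"
  have \<alpha>: "0 < \<alpha>" "\<alpha> < 1" using \<alpha>_bounds by auto
  hence "\<alpha> ^ m \<le> 1" by (simp add: power_le_one)
  hence c: "c \<ge> 0" using \<alpha> \<gamma> smoothing_error_nonneg by (simp add: c_def)
  have r: "r \<ge> 0" using c \<alpha> gap_nonneg[of x0] by (simp add: r_def sum_nonneg)
  have "(\<integral>\<^sup>+\<omega>. ennreal (gap (snapshot (Suc t) \<omega>)) \<partial>M)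
      \<le> ennreal (\<alpha> ^ m * r + (1 - \<alpha> ^ m) / (1 - \<alpha>) * (\<gamma> * (\<beta> t)\<^sup>2 * smoothing_error))"
    using Suc by (intro expected_gap_outer_step r) (auto simp: r_def c_def)
  also have "\<alpha> ^ m * r + (1 - \<alpha> ^ m) / (1 - \<alpha>) * (\<gamma> * (\<beta> t)\<^sup>2 * smoothing_error)
      = \<alpha> ^ (m * Suc t) * (gap x0 + c * (\<Sum>i<Suc t. (\<beta> i)\<^sup>2 / \<alpha> ^ (m * (i + 1))))"
  proof -
    have "\<alpha> ^ (m * Suc t) * (c * ((\<beta> t)\<^sup>2 / \<alpha> ^ (m * (t + 1)))) = c * (\<beta> t)\<^sup>2"
      using \<alpha> by simp
    moreover have "\<alpha> ^ (m * Suc t) = \<alpha> ^ m * \<alpha> ^ (m * t)" by (simp add: power_add)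
    moreover have "(1 - \<alpha> ^ m) / (1 - \<alpha>) * (\<gamma> * (\<beta> t)\<^sup>2 * smoothing_error) = c * (\<beta> t)\<^sup>2" by (simp add: c_def)
    ultimately show ?thesis unfolding r_def sum.lessThan_Suc distrib_left by simp
  qed
  finally show ?case by (simp only: c_def)
qed

end

theorem theorem2:
  fixes f :: "nat \<Rightarrow> real ^ 'd \<Rightarrow> real"
    and h :: "real ^ 'd \<Rightarrow> ereal"
    and e :: "nat \<Rightarrow> real ^ 'd"
    and x0 :: "real ^ 'd"
    and M :: "'w measure"
    and \<nu> :: "(real ^ 'd ^ 'd) measure"
    and idx :: "nat \<Rightarrow> nat \<Rightarrow> nat \<Rightarrow> 'w \<Rightarrow> nat"
    and Gs :: "nat \<Rightarrow> nat \<Rightarrow> nat \<Rightarrow> 'w \<Rightarrow> real ^ 'd ^ 'd"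
    and \<beta> :: "nat \<Rightarrow> real"
    and n m b l T \<tau> :: nat
    and L \<mu> \<gamma> \<alpha> \<theta> :: real
    and F :: "real ^ 'd \<Rightarrow> ereal"
    and X :: "nat \<Rightarrow> 'w \<Rightarrow> real ^ 'd"
  assumes "n \<ge> 1" "m \<ge> 1" "b \<ge> 1" "T \<ge> 1"
    and "1 \<le> l" "l \<le> CARD('d)"
    and "\<And>t. \<beta> t > 0"
    and "bij_betw e {1..CARD('d)} Basis"
    and "L > 0"
    and "\<And>i x. i \<in> {1..n} \<Longrightarrow> f i differentiable (at x)"
    and "\<And>i x y. i \<in> {1..n} \<Longrightarrow>
           norm (gradient (f i) x - gradient (f i) y) \<le> L * norm (x - y)"
    and "\<And>x. h x \<noteq> -\<infinity>"
    and "convex_ereal h"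
    and "proximable h"
    and "F = objective (f_avg n f) h"
    and "has_minimum F"
    and "RPL \<mu> \<gamma> (f_avg n f) h"
    and "\<alpha> = 1 - \<gamma> * \<mu> / 2"
    and "\<theta> = 1 - \<mu> * \<gamma> / 2 - \<mu> * \<gamma> * real m"
    and "0 < \<gamma>"
    and "\<gamma> < Min {1 / (4 * L),
                   2 / \<mu> * (1 / (2 * real m + 1)),
                   sqrt (real b * \<theta>) / (10 * real m * L) * sqrt (real l / real CARD('d))}"
    and "prob_space M"
    and "haar_O \<nu>"
    and "vr_sampling M \<nu> n T m b idx Gs"
    and "X = (\<lambda>t \<omega>. vr_szd e l b n f h \<gamma> \<beta> m (\<lambda>t k j. idx t k j \<omega>) (\<lambda>t k j. Gs t k j \<omega>) x0 t)"
    and "\<tau> \<le> T"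
  shows "expected_gap M F (X (\<tau> + 1)) \<le>
    ennreal (\<alpha> ^ (m * (\<tau> + 1))) *
      (expected_gap M F (X 0) +
       ennreal ((1 - \<alpha> ^ m) / (1 - \<alpha>) * \<gamma> *
         (3 * L\<^sup>2 * (real CARD('d))\<^sup>2 / real l + L\<^sup>2 * real CARD('d) / 2) *
         (\<Sum>i=0..\<tau>. (\<beta> i)\<^sup>2 / \<alpha> ^ (m * (i + 1)))))"
proof -
  note n = assms(1) and m = assms(2) and b = assms(3) and l = assms(5,6) and \<beta> = assms(7)
    and e = assms(8) and L = assms(9) and diff = assms(10) and lip = assms(11)
    and F = assms(15) and \<alpha>_eq = assms(18) and \<theta>_eq = assms(19) and \<gamma> = assms(20) and step = assms(21)
  have \<mu>: "\<mu> > 0" using assms(17) by (simp add: RPL_def)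
  define H where "H x = real_of_ereal (h x)" for x
  \<comment> \<open>where \<open>h\<close> were infinite, so would be the gap, while the squared norm in the RPL inequality is finite\<close>
  have h_finite: "h x = ereal (H x)" for x
  proof -
    have "h x \<noteq> \<infinity>"
    proof
      assume "h x = \<infinity>"
      hence "ereal (2 * \<mu>) * (objective (f_avg n f) h x - min_value (objective (f_avg n f) h)) = \<infinity>"
        using \<mu> by (simp add: objective_def)
      moreover have "ereal (2 * \<mu>) * (objective (f_avg n f) h x - min_value (objective (f_avg n f) h))
          \<le> ereal ((norm (gradient_mapping \<gamma> (f_avg n f) h x))\<^sup>2)"
        using assms(17) unfolding RPL_def by blast
      ultimately show False by (metis ereal_infty_less_eq(1) PInfty_neq_ereal(1))
    qed
    with assms(12)[of x] show ?thesis unfolding H_def by (cases "h x") auto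
  qed
  have h: "h = (\<lambda>x. ereal (H x))" using h_finite by blast
  have F_real: "F x = ereal (f_avg n f x + H x)" for x by (simp add: F objective_def h_finite)
  obtain z where z: "is_arg_min F (\<lambda>_. True) z" using assms(16) by (auto simp: has_minimum_def)
  define Fmin where "Fmin = f_avg n f z + H z"
  have z_min: "F z \<le> F x" for x using z by (auto simp: is_arg_min_linorder)
  have "min_value F = F z"
    unfolding min_value_def by (intro antisym INF_lower INF_greatest z_min UNIV_I)
  hence min_F: "min_value F = ereal Fmin" by (simp add: F_real Fmin_def)
  \<comment> \<open>\<open>\<theta>\<close> lies in the unit interval, so it can be dropped after squaring the third bound on \<open>\<gamma>\<close>\<close>
  have step': "\<gamma> < 1 / (4 * L)" "\<gamma> < 2 / \<mu> * (1 / (2 * real m + 1))"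
    "\<gamma> < sqrt (real b * \<theta>) / (10 * real m * L) * sqrt (real l / real CARD('d))"
    using step by auto
  have \<gamma>_\<mu>: "\<gamma> * \<mu> * (2 * real m + 1) < 2"
    using step'(2) pos_less_divide_eq[of "\<mu> * (2 * real m + 1)" \<gamma> 2] \<mu>
    by (simp add: mult.assoc)
  have \<theta>: "0 \<le> \<theta>" "\<theta> \<le> 1" using \<gamma>_\<mu> \<gamma> \<mu> by (auto simp: \<theta>_eq algebra_simps)
  have "10 * real m * L * \<gamma> \<le> sqrt (real b * \<theta>) * sqrt (real l / real CARD('d))"
    using step'(3) m L by (simp add: field_simps)
  hence "(10 * real m * L * \<gamma>)\<^sup>2 \<le> (sqrt (real b * \<theta>) * sqrt (real l / real CARD('d)))\<^sup>2"
    using L \<gamma> by (intro power_mono) auto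
  also have "\<dots> = real b * \<theta> * (real l / real CARD('d))"
    using \<theta> by (simp add: power_mult_distrib)
  also have "\<dots> \<le> real b * 1 * (real l / real CARD('d))"
    using \<theta> by (intro mult_right_mono mult_left_mono) auto
  finally have batch: "100 * \<gamma>\<^sup>2 * (real m)\<^sup>2 * L\<^sup>2 * real CARD('d) \<le> real b * real l"
    by (simp add: field_simps power_mult_distrib)
  define s where "s = (\<lambda>(t, k, j) \<omega>. (idx t k j \<omega>, Gs t k j \<omega>))"
  have sampling: "prob_space.indep_vars M (\<lambda>_. count_space {1..n} \<Otimes>\<^sub>M O_borel) s ({0..T} \<times> {0..<m} \<times> {1..b})"
    "\<And>t k j. t \<le> T \<Longrightarrow> k < m \<Longrightarrow> j \<in> {1..b} \<Longrightarrow>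
        distr M (count_space {1..n} \<Otimes>\<^sub>M O_borel) (s (t, k, j)) = uniform_count_measure {1..n} \<Otimes>\<^sub>M \<nu>"
    using assms(24) by (auto simp: vr_sampling_def s_def)
  interpret M: prob_space M by (rule assms(22))
  interpret R: vr_szd_run f e n b l L H m \<gamma> \<mu> Fmin M \<nu> T s \<beta> x0
  proof unfold_locales
    show "Fmin \<le> f_avg n f x + H x" for x
      using z_min[of x] by (simp add: F_real Fmin_def)
    show "2 * \<mu> * (f_avg n f x + H x - Fmin)
        \<le> (norm (gradient_mapping \<gamma> (f_avg n f) (\<lambda>x. ereal (H x)) x))\<^sup>2" for x
    proof -
      have "ereal (2 * \<mu>) * (F x - min_value F) \<le> ereal ((norm (gradient_mapping \<gamma> (f_avg n f) h x))\<^sup>2)"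
        using assms(17) unfolding RPL_def F by blast
      thus ?thesis by (simp add: F_real min_F h)
    qed
    show "\<gamma> * (4 * L) \<le> 1" using step'(1) L by (simp add: field_simps)
    show "\<gamma> * \<mu> * (2 * real m + 1) \<le> 2" using \<gamma>_\<mu> by simp
  qed (use n m b l \<beta> e L diff lip \<mu> \<gamma> batch sampling assms(13,14,23) in \<open>auto simp: h[symmetric]\<close>)
  have X: "X t \<omega> = R.snapshot t \<omega>" for t \<omega>
    by (simp add: assms(25) R.snapshot_of_def s_def h)
  have gap: "expected_gap M F (X t) = (\<integral>\<^sup>+\<omega>. ennreal (R.gap (R.snapshot t \<omega>)) \<partial>M)" for t
    by (simp add: expected_gap_def F_real min_F X R.gap_def e2ennreal_ereal)
  have \<alpha>: "\<alpha> = R.\<alpha>" by (simp add: \<alpha>_eq R.\<alpha>_def)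
  have start: "expected_gap M F (X 0) = ennreal (R.gap x0)"
    by (simp add: gap R.snapshot_of_def M.emeasure_space_1)
  have \<alpha>01: "0 < \<alpha>" "\<alpha> < 1" using R.\<alpha>_bounds by (auto simp: \<alpha>)
  hence "\<alpha> ^ m \<le> 1" by (simp add: power_le_one)
  hence noise: "0 \<le> (1 - \<alpha> ^ m) / (1 - \<alpha>) * \<gamma> * R.smoothing_error * (\<Sum>i=0..\<tau>. (\<beta> i)\<^sup>2 / \<alpha> ^ (m * (i + 1)))"
    using \<alpha>01 \<gamma> R.smoothing_error_nonneg by (intro mult_nonneg_nonneg sum_nonneg) auto
  have "expected_gap M F (X (\<tau> + 1)) \<le> ennreal (\<alpha> ^ (m * (\<tau> + 1)) *
     (R.gap x0 + (1 - \<alpha> ^ m) / (1 - \<alpha>) * \<gamma> * R.smoothing_error * (\<Sum>i=0..\<tau>. (\<beta> i)\<^sup>2 / \<alpha> ^ (m * (i + 1)))))"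
    using R.expected_gap_bound[of "\<tau> + 1"] assms(26)
    by (simp only: gap \<alpha> Suc_eq_plus1[symmetric] lessThan_Suc_atMost atLeast0AtMost Suc_le_mono)
  also have "\<dots> = ennreal (\<alpha> ^ (m * (\<tau> + 1))) * (expected_gap M F (X 0) +
      ennreal ((1 - \<alpha> ^ m) / (1 - \<alpha>) * \<gamma> * R.smoothing_error * (\<Sum>i=0..\<tau>. (\<beta> i)\<^sup>2 / \<alpha> ^ (m * (i + 1)))))"
    unfolding start using noise \<alpha>01 R.gap_nonneg[of x0]
    by (subst ennreal_mult) (auto simp only: ennreal_plus intro!: add_nonneg_nonneg zero_le_power)
  finally show ?thesis by (simp only: R.smoothing_error_def)
qed

end
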